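(* Let $G=\mathrm{GIRG}(n,\beta,w_0,d)$ be a standard GIRG, let $k\ge3$, and let $U_k=\{v_1,\dots,v_k\}$ be a set of $k$ vertices chosen uniformly at random, where $v_1$ has weight $w_1$ and all vertices of $U_k\setminus\{v_1\}$ have the same weight $w_u\ge w_1$. Let $\mathcal{E}^c_{\mathrm{star}}$ be the event that $v_1$ is adjacent to all vertices of $U_k\setminus\{v_1\}$ and that $w_u\le c^dw_1$, for some constant $c\ge1$ with $c^2(w_1^2/(\tau n))^{1/d}\le1/4$. Then $$\Pr\big[U_k\text{ is a clique}\mid\mathcal{E}^c_{\mathrm{star}}\big]=\Big(\frac{w_u}{w_1}\Big)^{k-2}\Big(2^{-(k-1)}\Big((2-k)\Big(\frac{w_u}{w_1}\Big)^{1/d}+2(k-1)\Big)\Big)^d.$$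
   Context: Fix constants $\lambda>0$, $w_0>0$, $\beta>2$. A standard GIRG $\mathrm{GIRG}(n,\beta,w_0,d)$ has $n$ vertices; each vertex $v$ independently receives a weight $w_v$ with $\Pr[w_v\le x]=1-(x/w_0)^{1-\beta}$ for $x\ge w_0$, and independently a position $\mathbf{x}_v$ uniform on the torus $\mathbb{T}^d=[0,1)^d$. The distance is $d(\mathbf{x}_u,\mathbf{x}_v)=\max_{1\le i\le d}|x_{ui}-x_{vi}|_C$ with $|a-b|_C=\min\{|a-b|,1-|a-b|\}$. Distinct $u,v$ are adjacent iff $d(\mathbf{x}_u,\mathbf{x}_v)\le t_{uv}=\big(\frac{w_uw_v}{\tau n}\big)^{1/d}$, where $\tau=2^d/\lambda$.
   Formalization: The hypothesis w_u ≤ 2^d w_1 is added: if w_u > 2^d w_1, the star forces U_k to be a clique with probability 1, while the formula gives another value (e.g. 3/4 for d=1, k=3, w_u=3w_1). *)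

theory Defs
  imports "HOL-Probability.Probability"
begin

definition weight_cdf :: "real \<Rightarrow> real \<Rightarrow> real \<Rightarrow> real" where
  "weight_cdf \<beta> w0 x = (if x < w0 then 0 else 1 - (x / w0) powr (1 - \<beta>))"

definition weight_law :: "real \<Rightarrow> real \<Rightarrow> real measure" where
  "weight_law \<beta> w0 = interval_measure (weight_cdf \<beta> w0)"

definition torus_law :: "nat \<Rightarrow> (nat \<Rightarrow> real) measure" where
  "torus_law d = (\<Pi>\<^sub>M i\<in>{1..d}. uniform_measure lborel {0..<1})"

text \<open>The vertices are \<open>1, \<dots>, n\<close>. A sample point is a pair \<open>(W, X)\<close> of the weights \<open>W v\<close>
  and the positions \<open>X v\<close>; the graph is a function of it.\<close>

definition girg :: "nat \<Rightarrow> real \<Rightarrow> real \<Rightarrow> nat \<Rightarrow> ((nat \<Rightarrow> real) \<times> (nat \<Rightarrow> nat \<Rightarrow> real)) measure" where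
  "girg n \<beta> w0 d = (\<Pi>\<^sub>M v\<in>{1..n}. weight_law \<beta> w0) \<Otimes>\<^sub>M (\<Pi>\<^sub>M v\<in>{1..n}. torus_law d)"

text \<open>The law of the GIRG conditioned on the vertices \<open>v \<in> J\<close> having weights \<open>f v\<close>. As the weight
  law has no atoms, this is a null event; \<open>girg_disintegration\<close> below shows that this is
  a conditional distribution given the weights on \<open>J\<close>.\<close>

definition girg_given ::
  "nat \<Rightarrow> real \<Rightarrow> real \<Rightarrow> nat \<Rightarrow> nat set \<Rightarrow> (nat \<Rightarrow> real) \<Rightarrow>
     ((nat \<Rightarrow> real) \<times> (nat \<Rightarrow> nat \<Rightarrow> real)) measure" where
  "girg_given n \<beta> w0 d J f =
     (\<Pi>\<^sub>M v\<in>{1..n}. if v \<in> J then return borel (f v) else weight_law \<beta> w0)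
       \<Otimes>\<^sub>M (\<Pi>\<^sub>M v\<in>{1..n}. torus_law d)"

definition circ_dist :: "real \<Rightarrow> real \<Rightarrow> real" where
  "circ_dist a b = min \<bar>a - b\<bar> (1 - \<bar>a - b\<bar>)"

definition torus_dist :: "nat \<Rightarrow> (nat \<Rightarrow> real) \<Rightarrow> (nat \<Rightarrow> real) \<Rightarrow> real" where
  "torus_dist d x y = (MAX i\<in>{1..d}. circ_dist (x i) (y i))"

definition girg_tau :: "real \<Rightarrow> nat \<Rightarrow> real" where
  "girg_tau l d = 2 ^ d / l"

definition conn_threshold :: "nat \<Rightarrow> real \<Rightarrow> nat \<Rightarrow> real \<Rightarrow> real \<Rightarrow> real" where
  "conn_threshold n l d wu wv = (wu * wv / (girg_tau l d * real n)) powr (1 / real d)"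

definition girg_adj ::
  "nat \<Rightarrow> real \<Rightarrow> nat \<Rightarrow> (nat \<Rightarrow> real) \<times> (nat \<Rightarrow> nat \<Rightarrow> real) \<Rightarrow> nat \<Rightarrow> nat \<Rightarrow> bool" where
  "girg_adj n l d = (\<lambda>(W, X) u v.
     u \<noteq> v \<and> torus_dist d (X u) (X v) \<le> conn_threshold n l d (W u) (W v))"

definition is_clique :: "('a \<Rightarrow> 'a \<Rightarrow> bool) \<Rightarrow> 'a set \<Rightarrow> bool" where
  "is_clique E U \<longleftrightarrow> (\<forall>u\<in>U. \<forall>v\<in>U. u \<noteq> v \<longrightarrow> E u v)"

text \<open>A uniformly random \<open>k\<close>-set with a labelling \<open>v 1, \<dots>, v k\<close> of its elements is a uniformly
  random injective \<open>k\<close>-tuple of vertices.\<close>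

definition vertex_tuples :: "nat \<Rightarrow> nat \<Rightarrow> (nat \<Rightarrow> nat) set" where
  "vertex_tuples n k = {v \<in> {1..k} \<rightarrow>\<^sub>E {1..n}. inj_on v {1..k}}"

text \<open>The joint law of the tuple \<open>v\<close> and the GIRG, conditioned on \<open>v 1\<close> having weight \<open>w1\<close>
  and \<open>v 2, \<dots>, v k\<close> having weight \<open>wu\<close>.\<close>

definition girg_sample ::
  "nat \<Rightarrow> real \<Rightarrow> real \<Rightarrow> nat \<Rightarrow> nat \<Rightarrow> real \<Rightarrow> real \<Rightarrow>
     ((nat \<Rightarrow> nat) \<times> (nat \<Rightarrow> real) \<times> (nat \<Rightarrow> nat \<Rightarrow> real)) measure" where
  "girg_sample n \<beta> w0 d k w1 wu =
     uniform_count_measure (vertex_tuples n k) \<bind>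
       (\<lambda>v. distr (girg_given n \<beta> w0 d (v ` {1..k}) (\<lambda>u. if u = v 1 then w1 else wu))
                  (count_space (vertex_tuples n k) \<Otimes>\<^sub>M girg n \<beta> w0 d) (\<lambda>G. (v, G)))"

text \<open>Given the star, if \<open>wu > 2 ^ d * w1\<close> then \<open>conn_threshold n l d wu wu\<close> exceeds
  \<open>2 * conn_threshold n l d w1 wu\<close>, so \<open>v 2, \<dots>, v k\<close> are pairwise adjacent with certainty, while the closed
  formula for the clique probability is a \<open>d\<close>-th power whose base is strictly below 1. The formula
  therefore needs the assumption \<open>wu \<le> 2 ^ d * w1\<close>.\<close>

definition star_event ::
  "nat \<Rightarrow> real \<Rightarrow> nat \<Rightarrow> nat \<Rightarrow> real \<Rightarrow> (nat \<Rightarrow> nat) \<Rightarrow>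
     (nat \<Rightarrow> real) \<times> (nat \<Rightarrow> nat \<Rightarrow> real) \<Rightarrow> bool" where
  "star_event n l d k c v G \<longleftrightarrow>
     (\<forall>u \<in> v ` {1..k} - {v 1}. girg_adj n l d G (v 1) u \<and> fst G u \<le> c ^ d * fst G (v 1))"


lemma
  assumes "w0 > 0" "\<beta> > 2"
  shows real_distribution_weight_law: "real_distribution (weight_law \<beta> w0)"
    and measure_weight_law_atMost:
      "x \<ge> w0 \<Longrightarrow> measure (weight_law \<beta> w0) {..x} = 1 - (x / w0) powr (1 - \<beta>)"
proof -
  let ?F = "weight_cdf \<beta> w0"
  have le1: "(x / w0) powr (1 - \<beta>) \<le> 1" if "x \<ge> w0" for x
    using that assms powr_mono2'[of "1 - \<beta>" 1 "x / w0"] by simp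
  have mono: "?F x \<le> ?F y" if "x \<le> y" for x y
    using that assms le1[of y]
    by (auto simp: weight_cdf_def intro!: powr_mono2' divide_right_mono)
  have F_eq: "?F = (\<lambda>x. 1 - (max x w0 / w0) powr (1 - \<beta>))"
    using assms by (auto simp: weight_cdf_def fun_eq_iff max_def)
  have "continuous_on UNIV ?F"
    unfolding F_eq using assms by (intro continuous_intros) (auto simp: max_def)
  then have cont: "continuous (at_right a) ?F" for a
    by (rule continuous_on_imp_continuous_within) auto
  have bot: "(?F \<longlongrightarrow> 0) at_bot"
    by (rule tendsto_eventually)
      (auto simp: weight_cdf_def eventually_at_bot_linorder intro!: exI[of _ "w0 - 1"])
  have "filterlim (\<lambda>x. (1 / w0) * x) at_top at_top"
    using assms by (intro filterlim_tendsto_pos_mult_at_top[OF tendsto_const] filterlim_ident) auto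
  then have "((\<lambda>x. ((1 / w0) * x) powr (1 - \<beta>)) \<longlongrightarrow> 0) at_top"
    using assms by (intro tendsto_neg_powr) auto
  then have "((\<lambda>x. 1 - (x / w0) powr (1 - \<beta>)) \<longlongrightarrow> 1 - 0) at_top"
    by (intro tendsto_diff tendsto_const) simp
  then have top: "(?F \<longlongrightarrow> 1) at_top"
    by (simp, elim Lim_transform_eventually)
       (auto simp: weight_cdf_def eventually_at_top_linorder intro!: exI[of _ w0])
  show "real_distribution (weight_law \<beta> w0)"
    unfolding weight_law_def
    by (rule real_distribution_interval_measure[OF mono cont bot top])
  show "x \<ge> w0 \<Longrightarrow> measure (weight_law \<beta> w0) {..x} = 1 - (x / w0) powr (1 - \<beta>)"
    unfolding weight_law_def
    by (subst measure_interval_measure_Iic[OF mono cont bot]) (simp_all add: weight_cdf_def)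
qed

lemma sets_weight_law [simp, measurable_cong]: "sets (weight_law \<beta> w0) = sets borel"
  by (simp add: weight_law_def)

lemma space_weight_law [simp]: "space (weight_law \<beta> w0) = UNIV"
  by (simp add: weight_law_def)

lemma prob_space_torus_law: "prob_space (torus_law d)"
  unfolding torus_law_def
  by (intro prob_space_PiM prob_space_uniform_measure) auto

lemma PiM_return:
  assumes "finite J" "f \<in> extensional J"
  shows "(\<Pi>\<^sub>M v\<in>J. return borel (f v :: real)) = return (\<Pi>\<^sub>M v\<in>J. borel) f"
proof -
  interpret product_sigma_finite "\<lambda>v. return borel (f v)"
    by (simp add: product_sigma_finite_def prob_space_return prob_space_imp_sigma_finite)
  have sets: "sets (Pi\<^sub>M J (\<lambda>v. return borel (f v))) = sets (\<Pi>\<^sub>M v\<in>J. borel)"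
    by (intro sets_PiM_cong) auto
  show ?thesis
  proof (rule PiM_eqI[symmetric])
    fix A assume A: "\<And>i. i \<in> J \<Longrightarrow> A i \<in> sets (return borel (f i))"
    then have "Pi\<^sub>E J A \<in> sets (\<Pi>\<^sub>M v\<in>J. borel)"
      using assms by (intro sets_PiM_I_finite) auto
    then have "emeasure (return (\<Pi>\<^sub>M v\<in>J. borel) f) (Pi\<^sub>E J A) = indicator (Pi\<^sub>E J A) f"
      by simp
    also have "\<dots> = (\<Prod>i\<in>J. indicator (A i) (f i))"
    proof (cases "f \<in> Pi\<^sub>E J A")
      case True
      then show ?thesis by (simp add: PiE_mem)
    next
      case False
      then obtain i where "i \<in> J" "f i \<notin> A i"
        using assms by (auto simp: PiE_def)
      then show ?thesis using False assms by (auto intro!: prod_zero[symmetric] bexI[of _ i])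
    qed
    finally show "emeasure (return (\<Pi>\<^sub>M v\<in>J. borel) f) (Pi\<^sub>E J A) =
        (\<Prod>i\<in>J. emeasure (return borel (f i)) (A i))"
      using A by simp
  qed (simp_all only: assms sets sets_return)
qed

lemma girg_disintegration:
  assumes "w0 > 0" "\<beta> > 2" "J \<subseteq> {1..n}"
    and A: "A \<in> sets (girg n \<beta> w0 d)" and B: "B \<in> sets (\<Pi>\<^sub>M v\<in>J. weight_law \<beta> w0)"
  shows "emeasure (girg n \<beta> w0 d) {(W, X) \<in> A. restrict W J \<in> B} =
    (\<integral>\<^sup>+ f\<in>B. emeasure (girg_given n \<beta> w0 d J f) A \<partial>(\<Pi>\<^sub>M v\<in>J. weight_law \<beta> w0))"
proof -
  define P where "P = weight_law \<beta> w0"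
  define Q where "Q = (\<Pi>\<^sub>M v\<in>{1..n}. torus_law d)"
  define K where "K = {1..n} - J"
  define R where "R f v = (if v \<in> J then return borel (f v) else P)" for f :: "nat \<Rightarrow> real" and v
  define g where "g W = emeasure Q (Pair W -` A)" for W
  have J: "finite J" "finite K" "J \<inter> K = {}" "J \<union> K = {1..n}"
    using assms(3) finite_subset[of J "{1..n}"] by (auto simp: K_def)
  have P: "prob_space P"
    using real_distribution_weight_law[OF assms(1,2)] unfolding P_def real_distribution_def by simp
  have [simp, measurable_cong]: "sets P = sets borel" by (simp add: P_def)
  have [simp]: "space P = UNIV" by (simp add: P_def)
  have R: "prob_space (R f v)" for f v
    unfolding R_def using P by (auto intro: prob_space_return)
  have setsR: "sets (R f v) = sets borel" for f v by (auto simp: R_def)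
  interpret Q: prob_space Q
    unfolding Q_def by (intro prob_space_PiM prob_space_torus_law)
  interpret PP: product_sigma_finite "\<lambda>_. P"
    using P by (auto simp: product_sigma_finite_def intro: prob_space_imp_sigma_finite)
  have A': "A \<in> sets (Pi\<^sub>M {1..n} (\<lambda>_. P) \<Otimes>\<^sub>M Q)"
    using A unfolding girg_def P_def Q_def .
  have B': "B \<in> sets (Pi\<^sub>M J (\<lambda>_. P))"
    using B unfolding P_def .
  have setsI: "sets (Pi\<^sub>M {1..n} (R f)) = sets (Pi\<^sub>M {1..n} (\<lambda>_. P))" for f
    by (intro sets_PiM_cong) (auto simp: setsR)
  have gm: "g \<in> borel_measurable (Pi\<^sub>M {1..n} (\<lambda>_. P))"
    unfolding g_def using A' by (rule Q.measurable_emeasure_Pair)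
  have given: "emeasure (girg_given n \<beta> w0 d J f) A = (\<integral>\<^sup>+ h. g (merge J K (f, h)) \<partial>Pi\<^sub>M K (\<lambda>_. P))"
    if f: "f \<in> space (Pi\<^sub>M J (\<lambda>_. P))" for f
  proof -
    interpret RR: product_sigma_finite "R f"
      using R by (auto simp: product_sigma_finite_def intro: prob_space_imp_sigma_finite)
    have gm': "g \<in> borel_measurable (Pi\<^sub>M (J \<union> K) (R f))"
      using gm unfolding J measurable_cong_sets[OF setsI refl] .
    have "girg_given n \<beta> w0 d J f = Pi\<^sub>M {1..n} (R f) \<Otimes>\<^sub>M Q"
      unfolding girg_given_def Q_def R_def[abs_def] P_def ..
    moreover have "A \<in> sets (Pi\<^sub>M {1..n} (R f) \<Otimes>\<^sub>M Q)"
      using A' unfolding sets_pair_measure_cong[OF setsI refl] .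
    ultimately have "emeasure (girg_given n \<beta> w0 d J f) A = (\<integral>\<^sup>+ W. g W \<partial>Pi\<^sub>M (J \<union> K) (R f))"
      by (simp add: Q.emeasure_pair_measure_alt g_def J del: One_nat_def)
    also have "\<dots> = (\<integral>\<^sup>+ f'. \<integral>\<^sup>+ h. g (merge J K (f', h)) \<partial>Pi\<^sub>M K (R f) \<partial>Pi\<^sub>M J (R f))"
      by (rule RR.product_nn_integral_fold[OF J(3,1,2) gm'])
    also have "Pi\<^sub>M K (R f) = Pi\<^sub>M K (\<lambda>_. P)"
      by (intro PiM_cong) (auto simp: R_def K_def)
    also have "Pi\<^sub>M J (R f) = (\<Pi>\<^sub>M v\<in>J. return borel (f v))"
      by (intro PiM_cong) (auto simp: R_def)
    also have "\<dots> = return (\<Pi>\<^sub>M v\<in>J. borel) f"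
      using f J by (intro PiM_return) (auto simp: space_PiM PiE_def)
    also have "(\<integral>\<^sup>+ f'. \<integral>\<^sup>+ h. g (merge J K (f', h)) \<partial>Pi\<^sub>M K (\<lambda>_. P) \<partial>return (\<Pi>\<^sub>M v\<in>J. borel) f)
        = (\<integral>\<^sup>+ h. g (merge J K (f, h)) \<partial>Pi\<^sub>M K (\<lambda>_. P))"
    proof (rule nn_integral_return)
      show "f \<in> space (\<Pi>\<^sub>M v\<in>J. borel)" using f by (auto simp: space_PiM)
      interpret K: finite_product_sigma_finite "\<lambda>_. P" K by standard (use J in auto)
      have *: "sets (Pi\<^sub>M J (\<lambda>_. borel)) = sets (Pi\<^sub>M J (\<lambda>_. P))"
        by (intro sets_PiM_cong) auto
      have "(\<lambda>x. g (merge J K x)) \<in> borel_measurable (Pi\<^sub>M J (\<lambda>_. P) \<Otimes>\<^sub>M Pi\<^sub>M K (\<lambda>_. P))"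
        using gm unfolding J(4)[symmetric] by (rule measurable_compose[OF measurable_merge])
      then have "(\<lambda>f'. \<integral>\<^sup>+ h. g (merge J K (f', h)) \<partial>Pi\<^sub>M K (\<lambda>_. P)) \<in> borel_measurable (Pi\<^sub>M J (\<lambda>_. P))"
        by (intro K.borel_measurable_nn_integral) (simp add: case_prod_beta')
      then show "(\<lambda>f'. \<integral>\<^sup>+ h. g (merge J K (f', h)) \<partial>Pi\<^sub>M K (\<lambda>_. P)) \<in> borel_measurable (Pi\<^sub>M J (\<lambda>_. borel))"
        unfolding measurable_cong_sets[OF * refl] .
    qed
    finally show ?thesis .
  qed
  have rm: "(\<lambda>W. restrict W J) \<in> measurable (Pi\<^sub>M {1..n} (\<lambda>_. P)) (Pi\<^sub>M J (\<lambda>_. P))"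
    using assms(3) by (rule measurable_restrict_subset)
  define A2 where "A2 = {(W, X) \<in> A. restrict W J \<in> B}"
  have "A2 = A \<inter> ((\<lambda>\<omega>. restrict (fst \<omega>) J) -` B \<inter> space (Pi\<^sub>M {1..n} (\<lambda>_. P) \<Otimes>\<^sub>M Q))"
    using sets.sets_into_space[OF A'] by (auto simp: A2_def)
  also have "\<dots> \<in> sets (Pi\<^sub>M {1..n} (\<lambda>_. P) \<Otimes>\<^sub>M Q)"
    using A' measurable_sets[OF measurable_compose[OF measurable_fst rm] B'] by auto
  finally have A2: "A2 \<in> sets (Pi\<^sub>M {1..n} (\<lambda>_. P) \<Otimes>\<^sub>M Q)" .
  have im: "(\<lambda>W. indicator B (restrict W J) * g W) \<in> borel_measurable (Pi\<^sub>M (J \<union> K) (\<lambda>_. P))"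
    unfolding J(4)
    by (intro borel_measurable_times_ennreal gm measurable_compose[OF rm] borel_measurable_indicator B')
  have vim: "Pair W -` A2 = (if restrict W J \<in> B then Pair W -` A else {})" for W
    by (auto simp: A2_def)
  have "emeasure (girg n \<beta> w0 d) A2 = (\<integral>\<^sup>+ W. emeasure Q (Pair W -` A2) \<partial>Pi\<^sub>M {1..n} (\<lambda>_. P))"
    unfolding girg_def P_def[symmetric] Q_def[symmetric] using A2 by (rule Q.emeasure_pair_measure_alt)
  also have "\<dots> = (\<integral>\<^sup>+ W. indicator B (restrict W J) * g W \<partial>Pi\<^sub>M (J \<union> K) (\<lambda>_. P))"
    unfolding J by (intro nn_integral_cong) (simp add: vim g_def)
  also have "\<dots> = (\<integral>\<^sup>+ f. \<integral>\<^sup>+ h. indicator B (restrict (merge J K (f, h)) J) * g (merge J K (f, h))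
      \<partial>Pi\<^sub>M K (\<lambda>_. P) \<partial>Pi\<^sub>M J (\<lambda>_. P))"
    by (rule PP.product_nn_integral_fold[OF J(3,1,2) im])
  also have "\<dots> = (\<integral>\<^sup>+ f. emeasure (girg_given n \<beta> w0 d J f) A * indicator B f \<partial>Pi\<^sub>M J (\<lambda>_. P))"
  proof (intro nn_integral_cong)
    fix f assume f: "f \<in> space (Pi\<^sub>M J (\<lambda>_. P))"
    then have "restrict (merge J K (f, h)) J = f" for h
      by (auto simp: space_PiM merge_def PiE_def extensional_def fun_eq_iff)
    then show "(\<integral>\<^sup>+ h. indicator B (restrict (merge J K (f, h)) J) * g (merge J K (f, h))
      \<partial>Pi\<^sub>M K (\<lambda>_. P)) = emeasure (girg_given n \<beta> w0 d J f) A * indicator B f"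
      using f by (auto simp: given indicator_def)
  qed
  finally show ?thesis unfolding A2_def P_def .
qed

lemma finite_vertex_tuples: "finite (vertex_tuples n k)"
  unfolding vertex_tuples_def
  by (rule finite_subset[of _ "{1..k} \<rightarrow>\<^sub>E {1..n}"]) (auto intro!: finite_PiE)

lemma vertex_tuples_nonempty:
  assumes "k \<le> n"
  shows "vertex_tuples n k \<noteq> {}"
proof -
  have "restrict id {1..k} \<in> vertex_tuples n k"
    using assms by (auto simp: vertex_tuples_def inj_on_def)
  then show ?thesis by blast
qed

lemma sets_girg_given: "sets (girg_given n \<beta> w0 d J f) = sets (girg n \<beta> w0 d)"
  unfolding girg_given_def girg_def
  by (intro sets_pair_measure_cong sets_PiM_cong) auto

lemma prob_space_girg_given:
  assumes "w0 > 0" "\<beta> > 2"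
  shows "prob_space (girg_given n \<beta> w0 d J f)"
proof -
  have P: "prob_space (weight_law \<beta> w0)"
    using real_distribution_weight_law[OF assms] unfolding real_distribution_def by simp
  interpret A: prob_space "\<Pi>\<^sub>M v\<in>{1..n}. if v \<in> J then return borel (f v) else weight_law \<beta> w0"
    using P by (intro prob_space_PiM) (auto intro: prob_space_return)
  interpret B: prob_space "\<Pi>\<^sub>M v\<in>{1..n}. torus_law d"
    by (intro prob_space_PiM prob_space_torus_law)
  interpret pair_prob_space "\<Pi>\<^sub>M v\<in>{1..n}. if v \<in> J then return borel (f v) else weight_law \<beta> w0"
    "\<Pi>\<^sub>M v\<in>{1..n}. torus_law d" ..
  show ?thesis unfolding girg_given_def by unfold_locales
qed

lemma
  assumes "w0 > 0" "\<beta> > 2" "k \<le> n"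
  shows prob_space_girg_sample: "prob_space (girg_sample n \<beta> w0 d k w1 wu)"
    and sets_girg_sample: "sets (girg_sample n \<beta> w0 d k w1 wu) =
          sets (count_space (vertex_tuples n k) \<Otimes>\<^sub>M girg n \<beta> w0 d)"
proof -
  let ?T = "vertex_tuples n k"
  let ?N = "count_space ?T \<Otimes>\<^sub>M girg n \<beta> w0 d"
  let ?K = "\<lambda>v. distr (girg_given n \<beta> w0 d (v ` {1..k}) (\<lambda>u. if u = v 1 then w1 else wu)) ?N (\<lambda>G. (v, G))"
  have prob: "prob_space (?K v)" if "v \<in> ?T" for v
  proof (rule prob_space.prob_space_distr[OF prob_space_girg_given[OF assms(1,2)]])
    show "(\<lambda>G. (v, G)) \<in> measurable (girg_given n \<beta> w0 d (v ` {1..k}) (\<lambda>u. if u = v 1 then w1 else wu)) ?N"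
      unfolding measurable_cong_sets[OF sets_girg_given refl] using that by (intro measurable_Pair) auto
  qed
  have K: "?K \<in> measurable (count_space ?T) (subprob_algebra ?N)"
    using prob by (auto simp: space_subprob_algebra prob_space_imp_subprob_space)
  have K': "?K \<in> measurable (uniform_count_measure ?T) (subprob_algebra ?N)"
    using K by (simp add: measurable_cong_sets[OF sets_uniform_count_measure_count_space refl])
  have ne: "space (uniform_count_measure ?T) \<noteq> {}"
    using vertex_tuples_nonempty[OF assms(3)] by (simp add: space_uniform_count_measure)
  interpret prob_space "uniform_count_measure ?T"
    by (intro prob_space_uniform_count_measure finite_vertex_tuples vertex_tuples_nonempty assms)
  show "prob_space (girg_sample n \<beta> w0 d k w1 wu)"
    unfolding girg_sample_def
    by (intro prob_space_bind[OF _ K'] AE_I2 prob) (simp add: space_uniform_count_measure)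
  show "sets (girg_sample n \<beta> w0 d k w1 wu) = sets ?N"
    unfolding girg_sample_def by (rule sets_bind[OF _ ne]) simp
qed

end

theory Submission
  imports Defs
begin

text \<open>The maximum metric makes both the star and the clique a conjunction over the \<open>d\<close> coordinates,
  and the coordinates are independent, so it suffices to treat one circle and take \<open>d\<close>-th powers.
  On the circle, rotate \<open>v 1\<close> to \<open>1 / 2\<close>. Let \<open>s\<close> and \<open>t\<close> be the thresholds between \<open>v 1\<close> and another
  vertex, and between two other vertices. Since \<open>s \<le> 1 / 4\<close>, the \<open>m = k - 1\<close> other points lie in an
  interval of length \<open>2 * s \<le> 1 / 2\<close>, on which the circle distance is the usual one. Splitting
  according to the leftmost point, which leaves the others the window of length \<open>t\<close> to its
  right, the volume of the configurations with pairwise distances at most \<open>t\<close> is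
  \<open>m * 2 * s * t ^ (m - 1) - (m - 1) * t ^ m\<close>. Dividing by the volume \<open>(2 * s) ^ m\<close> of the star and
  inserting \<open>t / s = (wu / w1) powr (1 / d)\<close> gives the formula.\<close>

text \<open>Without the predicate forms, the method \<open>measurable\<close> fails on comparisons of coordinates
  such as \<open>x i \<le> x j\<close>, where the sample point itself is a function.\<close>

declare borel_measurable_le [unfolded pred_def [symmetric], measurable (raw)]
declare borel_measurable_eq [unfolded pred_def [symmetric], measurable (raw)]

section \<open>The uniform law of a single coordinate\<close>

abbreviation unit_law :: "real measure" where
  "unit_law \<equiv> uniform_measure lborel {0..<1}"

lemma prob_space_unit_law: "prob_space unit_law"
  by (intro prob_space_uniform_measure) auto

lemma emeasure_unit_law: "A \<in> sets borel \<Longrightarrow> emeasure unit_law A = emeasure lborel ({0..<1} \<inter> A)"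
  by (simp add: divide_ennreal_def)

lemma emeasure_unit_law_subset:
  "A \<in> sets borel \<Longrightarrow> A \<subseteq> {0..<1} \<Longrightarrow> emeasure unit_law A = emeasure lborel A"
  by (simp add: divide_ennreal_def Int_absorb1)

lemma AE_unit_law: "AE x in unit_law. x \<in> {0..<1}"
  by (intro AE_uniform_measureI) auto

lemma product_sigma_finite_unit_law: "product_sigma_finite (\<lambda>_. unit_law)"
  by (simp add: product_sigma_finite_def prob_space_unit_law prob_space_imp_sigma_finite)

text \<open>The target is \<open>borel\<close> rather than \<open>unit_law\<close>, so that the
  method \<open>measurable\<close> can treat coordinates as real-valued functions and compare
  them.\<close>

lemma borel_measurable_unit_law_component [measurable (raw)]:
  assumes "i \<in> I"
  shows "(\<lambda>y. y i) \<in> borel_measurable (\<Pi>\<^sub>M i\<in>I. unit_law)"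
proof -
  have "(\<lambda>y. y i) \<in> measurable (\<Pi>\<^sub>M i\<in>I. unit_law) unit_law"
    using assms by (rule measurable_component_singleton)
  also have "measurable (\<Pi>\<^sub>M i\<in>I. unit_law) unit_law = borel_measurable (\<Pi>\<^sub>M i\<in>I. unit_law)"
    by (intro measurable_cong_sets) auto
  finally show ?thesis .
qed

subsection \<open>Clusters in an interval\<close>

text \<open>The volume of the set of \<open>m\<close>-tuples in an interval of length \<open>r\<close> whose entries have pairwise
  distance at most \<open>t \<le> r\<close>.\<close>

definition cluster_volume :: "real \<Rightarrow> nat \<Rightarrow> real \<Rightarrow> real" where
  "cluster_volume r m t = real m * r * t ^ (m - 1) - (real m - 1) * t ^ m"

text \<open>Here \<open>a\<close> is the leftmost point and \<open>min (a + t) q - a\<close> is the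
  length of the window left for each of the \<open>m\<close> others. The window has full length
  \<open>t\<close> up to \<open>a = q - t\<close> and is cut off by \<open>q\<close> afterwards, so
  the integral splits there; \<open>t \<le> q - p\<close> keeps the breakpoint in
  \<open>{p..q}\<close>.\<close>

lemma nn_integral_min_power:
  fixes p q t :: real
  assumes "0 \<le> t" "t \<le> q - p"
  shows "(\<integral>\<^sup>+ a. ennreal ((min (a + t) q - a) ^ m) * indicator {p..q} a \<partial>lborel)
    = ennreal ((q - p - t) * t ^ m + t ^ Suc m / real (Suc m))"
proof -
  let ?f = "\<lambda>a. (min (a + t) q - a) ^ m"
  have "((\<lambda>a. t ^ m) has_integral (q - t - p) *\<^sub>R t ^ m) {p..q - t}"
    using assms has_integral_const_real[of "t ^ m" p "q - t"] by simp
  then have 1: "(?f has_integral (q - p - t) * t ^ m) {p..q - t}"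
    by (rule has_integral_eq_rhs[OF has_integral_eq, rotated]) (auto simp: min_def)
  have "((\<lambda>a. (q - a) ^ m) has_integral (- ((q - q) ^ Suc m / real (Suc m))) - (- ((q - (q - t)) ^ Suc m / real (Suc m)))) {q - t..q}"
    using assms
    by (intro fundamental_theorem_of_calculus)
       (auto simp del: power_Suc intro!: derivative_eq_intros simp: has_real_derivative_iff_has_vector_derivative[symmetric])
  then have 2: "(?f has_integral t ^ Suc m / real (Suc m)) {q - t..q}"
    by (rule has_integral_eq_rhs[OF has_integral_eq, rotated]) (auto simp: min_def intro!: arg_cong[where f = "\<lambda>z. z ^ m"])
  have "(?f has_integral ((q - p - t) * t ^ m + t ^ Suc m / real (Suc m))) {p..q}"
    using assms by (intro has_integral_combine[OF _ _ 1 2]) auto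
  moreover have "(\<lambda>a. if a \<in> {p..q} then ?f a else 0) = (\<lambda>a. ?f a * indicator {p..q} a)"
    by (auto simp: fun_eq_iff)
  ultimately have "((\<lambda>a. ?f a * indicator {p..q} a) has_integral
      ((q - p - t) * t ^ m + t ^ Suc m / real (Suc m))) UNIV"
    by (subst (asm) has_integral_restrict_UNIV[symmetric]) simp
  then have "(\<integral>\<^sup>+ a. ennreal (?f a * indicator {p..q} a) \<partial>lborel) = ennreal ((q - p - t) * t ^ m + t ^ Suc m / real (Suc m))"
    using assms by (intro nn_integral_has_integral_lborel) (auto simp: indicator_def)
  then show ?thesis
    by (simp add: ennreal_mult'' ennreal_indicator)
qed

text \<open>Given its leftmost coordinate, a configuration is a box of independent coordinates, so
  each choice of the leftmost index contributes the integral of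
  \<open>nn_integral_min_power\<close>. The contributions are equal, and their number
  \<open>card I\<close> cancels the denominator \<open>Suc m\<close>. The bounds on \<open>p\<close>
  and \<open>q\<close> place the interval inside \<open>{0..<1}\<close>, where
  \<open>unit_law\<close> is Lebesgue measure.\<close>

lemma emeasure_window:
  fixes I :: "nat set"
  assumes I: "finite I" "I \<noteq> {}" and "0 \<le> p" "q < 1" "0 \<le> t" "t \<le> q - p"
  shows "emeasure (\<Pi>\<^sub>M i\<in>I. unit_law) {y \<in> space (\<Pi>\<^sub>M i\<in>I. unit_law).
      (\<forall>i\<in>I. y i \<in> {p..q}) \<and> (\<forall>i\<in>I. \<forall>j\<in>I. \<bar>y i - y j\<bar> \<le> t)} = ennreal (cluster_volume (q - p) (card I) t)"
    (is "emeasure ?M ?S = _")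
proof -
  interpret product_sigma_finite "\<lambda>_. unit_law" by (rule product_sigma_finite_unit_law)
  define m where "m = card I - 1"
  have m: "card I = Suc m" using I by (simp add: m_def card_gt_0_iff)
  \<comment> \<open>\<open>D i\<close> is the part where \<open>i\<close> is the first index of a minimal coordinate. Breaking ties by index
    makes the \<open>D i\<close> a partition, without exceptional null sets.\<close>
  define C where "C i j a = (if j < i then {a<..min (a + t) q} else {a..min (a + t) q})" for i j :: nat and a
  define D where "D i = {y \<in> space ?M. y i \<in> {p..q} \<and> (\<forall>j\<in>I. j \<noteq> i \<longrightarrow> y j \<in> C i j (y i))}" for i
  have C_iff: "b \<in> C i j a \<longleftrightarrow> a \<le> b \<and> (j < i \<longrightarrow> a \<noteq> b) \<and> b \<le> a + t \<and> b \<le> q" for i j a b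
    by (auto simp: C_def)
  have [measurable]: "D i \<in> sets ?M" if i: "i \<in> I" for i
  proof -
    have "{y \<in> space ?M. j \<noteq> i \<longrightarrow> y j \<in> C i j (y i)} \<in> sets ?M" if "j \<in> I" for j
      unfolding C_iff using i that by (cases "j < i"; cases "j = i"; simp; measurable)
    moreover have "{y \<in> space ?M. y i \<in> {p..q}} \<in> sets ?M" using i by measurable
    moreover have "{y \<in> space ?M. \<forall>j\<in>I. j \<noteq> i \<longrightarrow> y j \<in> C i j (y i)} \<in> sets ?M"
      using I(1) calculation(1) by (rule sets.sets_Collect_finite_All[rotated])
    ultimately show ?thesis
      unfolding D_def by (intro sets.sets_Collect_conj)
  qed
  have S: "?S = (\<Union>i\<in>I. D i)"
  proof (intro equalityI subsetI)
    fix y assume y: "y \<in> ?S"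
    define i where "i = Min {i \<in> I. y i = Min (y ` I)}"
    have "Min (y ` I) \<in> y ` I" using I by (intro Min_in) auto
    then have "{i \<in> I. y i = Min (y ` I)} \<noteq> {}" by auto
    with I have "i \<in> {i \<in> I. y i = Min (y ` I)}" unfolding i_def by (intro Min_in) auto
    then have i: "i \<in> I" "y i = Min (y ` I)" by auto
    have le: "y i \<le> y j" if "j \<in> I" for j using i that I by auto
    have "y i \<noteq> y j" if "j \<in> I" "j < i" for j
    proof
      assume "y i = y j"
      with that i have "i \<le> j" unfolding i_def using I by (intro Min_le) auto
      with that show False by simp
    qed
    with le have lt: "y i < y j" if "j \<in> I" "j < i" for j using that by (metis order_le_less)
    have "y j \<le> y i + t" if "j \<in> I" for j
      using y i that by (auto simp: abs_le_iff algebra_simps)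
    then have "y \<in> D i" using y i(1) le by (auto simp: D_def C_iff dest: lt)
    with i show "y \<in> (\<Union>i\<in>I. D i)" by auto
  next
    fix y assume "y \<in> (\<Union>i\<in>I. D i)"
    then obtain i where i: "i \<in> I" "y \<in> D i" by auto
    have b: "y i \<le> y j" "y j \<le> y i + t" "y j \<le> q" if "j \<in> I" for j
      using i that assms by (cases "j = i"; force simp: D_def C_iff split: if_splits)+
    have "\<bar>y j - y k\<bar> \<le> t" if "j \<in> I" "k \<in> I" for j k
      using b[OF that(1)] b[OF that(2)] by linarith
    moreover have "y j \<in> {p..q}" if "j \<in> I" for j
      using b[OF that] i by (auto simp: D_def)
    ultimately show "y \<in> ?S" using i by (auto simp: D_def)
  qed
  have disj: "disjoint_family_on D I"
  proof -
    have "i = j" if "y \<in> D i" "y \<in> D j" "i \<in> I" "j \<in> I" for y i j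
    proof (rule ccontr)
      assume ne: "i \<noteq> j"
      then have "y j \<in> C i j (y i)" "y i \<in> C j i (y j)"
        using that by (auto simp: D_def)
      with ne show False by (auto simp: C_iff split: if_splits)
    qed
    then show ?thesis by (force simp: disjoint_family_on_def)
  qed
  have D: "emeasure ?M (D i) = ennreal ((q - p - t) * t ^ m + t ^ Suc m / real (Suc m))" if i: "i \<in> I" for i
  proof -
    let ?J = "I - {i}"
    have ins: "insert i ?J = I" using i by auto
    have fm: "(indicator (D i) :: _ \<Rightarrow> ennreal) \<in> borel_measurable (Pi\<^sub>M (insert i ?J) (\<lambda>_. unit_law))"
      unfolding ins using i by measurable
    have "emeasure ?M (D i) = (\<integral>\<^sup>+ y. indicator (D i) y \<partial>Pi\<^sub>M (insert i ?J) (\<lambda>_. unit_law))"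
      unfolding ins using i by simp
    also have "\<dots> = (\<integral>\<^sup>+ a. \<integral>\<^sup>+ x. indicator (D i) (x(i := a)) \<partial>Pi\<^sub>M ?J (\<lambda>_. unit_law) \<partial>unit_law)"
      using I by (intro product_nn_integral_insert_rev fm) auto
    also have "\<dots> = (\<integral>\<^sup>+ a. ennreal ((min (a + t) q - a) ^ m) * indicator {p..q} a \<partial>unit_law)"
    proof (rule nn_integral_cong)
      fix a :: real
      have C: "C i j a \<in> sets unit_law" for j by (simp add: C_def)
      then have box: "Pi\<^sub>E ?J (\<lambda>j. C i j a) \<in> sets (Pi\<^sub>M ?J (\<lambda>_. unit_law))"
        using I by (intro sets_PiM_I_finite) auto
      \<comment> \<open>With coordinate \<open>i\<close> fixed at \<open>a\<close>, the section of
        \<open>D i\<close> is a box if \<open>a\<close> lies in \<open>{p..q}\<close>, and empty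
        otherwise.\<close>
      have "(\<integral>\<^sup>+ x. indicator (D i) (x(i := a)) \<partial>Pi\<^sub>M ?J (\<lambda>_. unit_law)) =
          (\<integral>\<^sup>+ x. indicator (Pi\<^sub>E ?J (\<lambda>j. C i j a)) x * indicator {p..q} a \<partial>Pi\<^sub>M ?J (\<lambda>_. unit_law))"
        using i by (intro nn_integral_cong)
          (auto simp: D_def indicator_def space_PiM PiE_iff extensional_def)
      also have "\<dots> = emeasure (Pi\<^sub>M ?J (\<lambda>_. unit_law)) (Pi\<^sub>E ?J (\<lambda>j. C i j a)) * indicator {p..q} a"
        using box by (simp add: nn_integral_multc)
      also have "emeasure (Pi\<^sub>M ?J (\<lambda>_. unit_law)) (Pi\<^sub>E ?J (\<lambda>j. C i j a)) = (\<Prod>j\<in>?J. emeasure unit_law (C i j a))"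
        using I C by (intro emeasure_PiM) auto
      also have "(\<Prod>j\<in>?J. emeasure unit_law (C i j a)) * indicator {p..q} a =
        ennreal ((min (a + t) q - a) ^ m) * indicator {p..q} a"
      proof (cases "a \<in> {p..q}")
        case True
        \<comment> \<open>The left endpoint removed for \<open>j < i\<close> has measure zero, so
          the factor does not depend on \<open>j\<close>.\<close>
        have "emeasure unit_law (C i j a) = ennreal (min (a + t) q - a)" for j
        proof -
          have "emeasure unit_law (C i j a) = emeasure lborel (C i j a)"
            using True assms by (intro emeasure_unit_law_subset) (auto simp: C_def)
          also have "\<dots> = ennreal (min (a + t) q - a)"
            using True assms by (auto simp: C_def)
          finally show ?thesis .
        qed
        then show ?thesis using True i I assms m by (simp add: ennreal_power card_Diff_singleton)
      qed simp
      finally show "(\<integral>\<^sup>+ x. indicator (D i) (x(i := a)) \<partial>Pi\<^sub>M ?J (\<lambda>_. unit_law)) =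
         ennreal ((min (a + t) q - a) ^ m) * indicator {p..q} a" .
    qed
    also have "\<dots> = (\<integral>\<^sup>+ a. ennreal ((min (a + t) q - a) ^ m) * indicator {p..q} a \<partial>lborel)"
    proof -
      have "indicator {p..q} a * indicator {0..<1} a = (indicator {p..q} a :: ennreal)" for a
        using assms by (simp split: split_indicator)
      then show ?thesis
        by (subst nn_integral_uniform_measure) (auto simp: divide_ennreal_def mult.assoc)
    qed
    also have "\<dots> = ennreal ((q - p - t) * t ^ m + t ^ Suc m / real (Suc m))"
      by (rule nn_integral_min_power) fact+
    finally show ?thesis .
  qed
  have "emeasure ?M ?S = (\<Sum>i\<in>I. emeasure ?M (D i))"
    unfolding S using I disj by (intro sum_emeasure[symmetric]) auto
  also have "\<dots> = ennreal (real (Suc m) * ((q - p - t) * t ^ m + t ^ Suc m / real (Suc m)))"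
    using assms by (subst ennreal_mult) (simp_all add: D m ennreal_of_nat_eq_real_of_nat del: of_nat_Suc)
  also have "real (Suc m) * ((q - p - t) * t ^ m + t ^ Suc m / real (Suc m)) = cluster_volume (q - p) (card I) t"
    unfolding cluster_volume_def m by (simp add: field_simps)
  finally show ?thesis .
qed

subsection \<open>Clusters on the circle\<close>

text \<open>Rotation invariance of the circle: the rotation cuts \<open>{0..<1}\<close> into two
  pieces and translates each, and Lebesgue measure is translation invariant.\<close>

lemma distr_unit_law_frac: "distr unit_law unit_law (\<lambda>x. frac (x + b)) = unit_law"
proof (rule measure_eqI)
  fix A assume "A \<in> sets (distr unit_law unit_law (\<lambda>x. frac (x + b)))"
  then have A: "A \<in> sets borel" by simp
  define e where "e = frac b"
  have e: "0 \<le> e" "e < 1" by (auto simp: e_def frac_lt_1)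
  have frac_e: "frac (x + b) = (if x + e < 1 then x + e else x + e - 1)" if "x \<in> {0..<1}" for x
  proof -
    have "frac x = x" using that by (simp add: frac_eq)
    then show ?thesis using frac_add[of x b] by (simp add: e_def)
  qed
  have trans: "emeasure lborel {x. x + c \<in> B} = emeasure lborel B" if "B \<in> sets borel" for c :: real and B
  proof -
    have "emeasure lborel B = emeasure (distr lborel borel ((+) c)) B"
      by (simp add: lborel_distr_plus)
    also have "\<dots> = emeasure lborel ((+) c -` B \<inter> space lborel)"
      using that by (intro emeasure_distr) auto
    also have "(+) c -` B \<inter> space lborel = {x. x + c \<in> B}" by (auto simp: add.commute)
    finally show ?thesis ..
  qed
  have fm[measurable]: "(\<lambda>x::real. frac (x + b)) \<in> borel_measurable borel"
    unfolding frac_def by measurable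
  have "emeasure (distr unit_law unit_law (\<lambda>x. frac (x + b))) A = emeasure unit_law {x. frac (x + b) \<in> A}"
    using A by (subst emeasure_distr) (auto simp: vimage_def)
  also have "\<dots> = emeasure lborel ({0..<1} \<inter> {x. frac (x + b) \<in> A})"
    using measurable_sets_borel[OF fm A] by (intro emeasure_unit_law) (simp add: vimage_def)
  \<comment> \<open>Points that do not wrap around land in \<open>{e..<1}\<close>, those that do
    land in \<open>{0..<e}\<close>; the images are disjoint and cover the circle.\<close>
  also have "{0..<1} \<inter> {x. frac (x + b) \<in> A} =
      {x. x + e \<in> A \<inter> {e..<1}} \<union> {x. x + (e - 1) \<in> A \<inter> {0..<e}}"
    using e by (auto simp: frac_e algebra_simps split: if_splits)
  also have "emeasure lborel \<dots> = emeasure lborel {x. x + e \<in> A \<inter> {e..<1}} + emeasure lborel {x. x + (e - 1) \<in> A \<inter> {0..<e}}"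
    using A by (intro plus_emeasure[symmetric]) auto
  also have "\<dots> = emeasure lborel (A \<inter> {e..<1}) + emeasure lborel (A \<inter> {0..<e})"
    using A by (simp only: trans sets.Int borel_closed atLeastLessThan_borel)
  also have "\<dots> = emeasure lborel (A \<inter> {e..<1} \<union> A \<inter> {0..<e})"
    using A by (intro plus_emeasure) auto
  also have "A \<inter> {e..<1} \<union> A \<inter> {0..<e} = {0..<1} \<inter> A" using e by auto
  also have "emeasure lborel \<dots> = emeasure unit_law A" using A by (rule emeasure_unit_law[symmetric])
  finally show "emeasure (distr unit_law unit_law (\<lambda>x. frac (x + b))) A = emeasure unit_law A" .
qed simp

lemma circ_dist_commute: "circ_dist a b = circ_dist b a"
  by (simp add: circ_dist_def abs_minus_commute)

lemma circ_dist_le_half: "circ_dist a b \<le> 1 / 2"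
  by (simp add: circ_dist_def min_def)

text \<open>Rotations are isometries. If both points wrap around or neither does, the difference is
  unchanged; if exactly one does, \<open>\<bar>x - y\<bar>\<close> turns into
  \<open>1 - \<bar>x - y\<bar>\<close>, and the minimum is symmetric in the two.\<close>

lemma circ_dist_frac:
  assumes "x \<in> {0..<1}" "y \<in> {0..<1}"
  shows "circ_dist (frac (x + b)) (frac (y + b)) = circ_dist x y"
proof -
  have "frac x = x" "frac y = y" using assms by (auto simp: frac_eq)
  then have *: "frac (x + b) = (if x + frac b < 1 then x + frac b else x + frac b - 1)"
    "frac (y + b) = (if y + frac b < 1 then y + frac b else y + frac b - 1)"
    using frac_add[of x b] frac_add[of y b] by auto
  show ?thesis unfolding * circ_dist_def using assms by (auto simp: min_def)
qed

lemma borel_measurable_circ_dist [measurable]: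
  assumes [measurable]: "f \<in> borel_measurable M" "g \<in> borel_measurable M"
  shows "(\<lambda>x. circ_dist (f x) (g x)) \<in> borel_measurable M"
  unfolding circ_dist_def by measurable

text \<open>Rotating the centre to \<open>1 / 2\<close> turns the arc of radius \<open>s\<close>
  into an interval that stays away from the cut at \<open>0\<close>, so
  \<open>emeasure_window\<close> applies. Points of the arc are at most \<open>2 * s\<close> apart
  anyway; capping \<open>t\<close> there changes nothing and meets the requirement that the distance
  bound not exceed the length of the interval.\<close>

lemma emeasure_circle_cluster_centred:
  fixes I :: "nat set"
  assumes I: "finite I" "I \<noteq> {}" and a: "a \<in> {0..<1}" and s: "0 \<le> s" "s \<le> 1 / 4" and t: "0 \<le> t"
  shows "emeasure (\<Pi>\<^sub>M i\<in>I. unit_law) {x \<in> space (\<Pi>\<^sub>M i\<in>I. unit_law).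
      (\<forall>i\<in>I. circ_dist a (x i) \<le> s) \<and> (\<forall>i\<in>I. \<forall>j\<in>I. circ_dist (x i) (x j) \<le> t)}
    = ennreal (cluster_volume (2 * s) (card I) (min t (2 * s)))"
    (is "emeasure ?M ?S = _")
proof -
  define r where "r x = frac (x + (1 / 2 - a))" for x
  let ?W = "{y \<in> space ?M. (\<forall>i\<in>I. y i \<in> {1/2 - s..1/2 + s}) \<and> (\<forall>i\<in>I. \<forall>j\<in>I. \<bar>y i - y j\<bar> \<le> min t (2 * s))}"
  have ra: "r a = 1 / 2" by (simp add: r_def frac_eq)
  have rr: "r x \<in> {0..<1}" for x by (simp add: r_def frac_lt_1)
  have centre: "circ_dist (1 / 2) y \<le> s \<longleftrightarrow> y \<in> {1/2 - s..1/2 + s}" if "y \<in> {0..<1}" for y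
    using that s by (auto simp: circ_dist_def min_def abs_if split: if_splits)
  \<comment> \<open>Because \<open>2 * s \<le> 1 / 2\<close>, going the other way round the circle
    is never shorter, so \<open>circ_dist\<close> is the absolute difference.\<close>
  have close: "circ_dist y z \<le> t \<longleftrightarrow> \<bar>y - z\<bar> \<le> min t (2 * s)"
    if "y \<in> {1/2 - s..1/2 + s}" "z \<in> {1/2 - s..1/2 + s}" for y z
  proof -
    have "\<bar>y - z\<bar> \<le> 2 * s" using that by (auto simp: abs_le_iff)
    with s show ?thesis by (auto simp: circ_dist_def min_def)
  qed
  have r[measurable]: "r \<in> measurable unit_law unit_law"
    unfolding r_def frac_def by measurable
  have "distr unit_law unit_law r = unit_law"
    using distr_unit_law_frac[of "1 / 2 - a"] by (simp add: r_def[abs_def])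
  \<comment> \<open>The rotation preserves every factor, hence the product.\<close>
  then have M: "?M = distr ?M ?M (compose I r)"
    using I r by (subst distr_PiM_finite_prob_space') (auto simp: prob_space_unit_law)
  have cm: "compose I r \<in> measurable ?M ?M"
    unfolding compose_def by measurable
  have W[measurable]: "?W \<in> sets ?M" using I by measurable
  have S[measurable]: "?S \<in> sets ?M" using I by measurable
  have "ennreal (cluster_volume (2 * s) (card I) (min t (2 * s))) = emeasure ?M ?W"
    using s t by (subst emeasure_window[OF I]) (auto simp: algebra_simps)
  also have "\<dots> = emeasure ?M (compose I r -` ?W \<inter> space ?M)"
    by (subst M, rule emeasure_distr[OF cm W])
  also have "\<dots> = emeasure ?M ?S"
  proof (rule emeasure_eq_AE)
    \<comment> \<open>The underlying space of \<open>unit_law\<close> is all of the reals, whereas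
      \<open>circ_dist_frac\<close> needs representatives in \<open>{0..<1}\<close>; the two events
      therefore agree only almost everywhere.\<close>
    have "AE x in ?M. \<forall>i\<in>I. x i \<in> {0..<1}"
      using I by (intro AE_finite_allI AE_PiM_component AE_unit_law prob_space_unit_law) auto
    then show "AE x in ?M. x \<in> compose I r -` ?W \<inter> space ?M \<longleftrightarrow> x \<in> ?S"
    proof eventually_elim
      fix x :: "nat \<Rightarrow> real" assume x: "\<forall>i\<in>I. x i \<in> {0..<1}"
      have "compose I r x \<in> space ?M" by (auto simp: space_PiM compose_def)
      moreover have "circ_dist a (x i) \<le> s \<longleftrightarrow> r (x i) \<in> {1/2 - s..1/2 + s}" if "i \<in> I" for i
        using circ_dist_frac[of a "x i" "1/2 - a"] a x that centre[of "r (x i)"] rr ra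
        by (simp add: r_def[symmetric])
      moreover have "circ_dist (x i) (x j) = circ_dist (r (x i)) (r (x j))" if "i \<in> I" "j \<in> I" for i j
        using x that by (simp add: r_def circ_dist_frac)
      ultimately show "x \<in> compose I r -` ?W \<inter> space ?M \<longleftrightarrow> x \<in> ?S"
        using close by (auto simp: compose_def)
    qed
    show "compose I r -` ?W \<inter> space ?M \<in> sets ?M" by (rule measurable_sets[OF cm W])
  qed fact
  finally show ?thesis ..
qed

text \<open>The measure for a fixed centre does not depend on the centre, so integrating over the
  random centre \<open>x z\<close> leaves it unchanged.\<close>

lemma emeasure_circle_cluster:
  fixes I :: "nat set"
  assumes I: "finite I" "I \<noteq> {}" "z \<notin> I" and s: "0 \<le> s" "s \<le> 1 / 4" and t: "0 \<le> t"
  defines "M \<equiv> \<Pi>\<^sub>M i\<in>insert z I. unit_law"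
  shows "emeasure M {x \<in> space M.
      (\<forall>i\<in>I. circ_dist (x z) (x i) \<le> s) \<and> (\<forall>i\<in>I. \<forall>j\<in>I. circ_dist (x i) (x j) \<le> t)}
    = ennreal (cluster_volume (2 * s) (card I) (min t (2 * s)))"
    (is "emeasure M ?S = _")
proof -
  interpret product_sigma_finite "\<lambda>_. unit_law" by (rule product_sigma_finite_unit_law)
  interpret U: prob_space unit_law by (rule prob_space_unit_law)
  let ?N = "\<Pi>\<^sub>M i\<in>I. unit_law"
  let ?T = "\<lambda>a. {x \<in> space ?N. (\<forall>i\<in>I. circ_dist a (x i) \<le> s) \<and> (\<forall>i\<in>I. \<forall>j\<in>I. circ_dist (x i) (x j) \<le> t)}"
  have S[measurable]: "?S \<in> sets M" unfolding M_def using I by measurable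
  have "emeasure M ?S = (\<integral>\<^sup>+ x. indicator ?S x \<partial>M)" by simp
  also have "\<dots> = (\<integral>\<^sup>+ a. \<integral>\<^sup>+ x. indicator ?S (x(z := a)) \<partial>?N \<partial>unit_law)"
    using S unfolding M_def by (intro product_nn_integral_insert_rev I borel_measurable_indicator)
  also have "\<dots> = (\<integral>\<^sup>+ a. ennreal (cluster_volume (2 * s) (card I) (min t (2 * s))) \<partial>unit_law)"
  proof (rule nn_integral_cong_AE, use AE_unit_law in eventually_elim)
    fix a :: real assume a: "a \<in> {0..<1}"
    have [measurable]: "?T a \<in> sets ?N" using I by measurable
    have "(\<integral>\<^sup>+ x. indicator ?S (x(z := a)) \<partial>?N) = (\<integral>\<^sup>+ x. indicator (?T a) x \<partial>?N)"
    proof (rule nn_integral_cong)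
      fix x assume x: "x \<in> space ?N"
      then have "x(z := a) \<in> space M" by (auto simp: M_def space_PiM PiE_iff extensional_def)
      moreover have "(x(z := a)) i = x i" if "i \<in> I" for i using that I by auto
      ultimately show "indicator ?S (x(z := a)) = (indicator (?T a) x :: ennreal)"
        using x by (simp add: indicator_def)
    qed
    also have "\<dots> = emeasure ?N (?T a)" by simp
    also have "\<dots> = ennreal (cluster_volume (2 * s) (card I) (min t (2 * s)))"
      by (rule emeasure_circle_cluster_centred) fact+
    finally show "(\<integral>\<^sup>+ x. indicator ?S (x(z := a)) \<partial>?N) = ennreal (cluster_volume (2 * s) (card I) (min t (2 * s)))" .
  qed
  finally show ?thesis by (simp add: U.emeasure_space_1[simplified])
qed

subsection \<open>Independence of the coordinates\<close>

lemma prob_space_PiM_unit_law: "prob_space (\<Pi>\<^sub>M i\<in>I. unit_law)"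
  by (intro prob_space_PiM prob_space_unit_law)

lemma measurable_PiM_flatten:
  "(\<lambda>X. \<lambda>z\<in>I \<times> J. X (fst z) (snd z)) \<in>
     measurable (\<Pi>\<^sub>M i\<in>I. \<Pi>\<^sub>M j\<in>J. unit_law) (\<Pi>\<^sub>M z\<in>I \<times> J. unit_law)"
proof (rule measurable_restrict)
  fix z assume "z \<in> I \<times> J"
  then show "(\<lambda>X. X (fst z) (snd z)) \<in> measurable (\<Pi>\<^sub>M i\<in>I. \<Pi>\<^sub>M j\<in>J. unit_law) unit_law"
    by (intro measurable_compose[where f = "\<lambda>X. X (fst z)" and g = "\<lambda>x. x (snd z)" and N = "\<Pi>\<^sub>M i\<in>J. unit_law"]
      measurable_component_singleton) auto
qed

text \<open>A product of products is a product over pairs, since both measures agree on boxes. The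
  product over pairs is the common ground on which vertices and coordinates can be
  exchanged.\<close>

lemma distr_PiM_flatten:
  assumes "finite I" "finite J"
  shows "distr (\<Pi>\<^sub>M i\<in>I. \<Pi>\<^sub>M j\<in>J. unit_law) (\<Pi>\<^sub>M z\<in>I \<times> J. unit_law)
    (\<lambda>X. \<lambda>z\<in>I \<times> J. X (fst z) (snd z)) = (\<Pi>\<^sub>M z\<in>I \<times> J. unit_law)"
    (is "distr ?A ?P ?f = ?P")
proof -
  interpret U: product_sigma_finite "\<lambda>_. unit_law" by (rule product_sigma_finite_unit_law)
  interpret J: product_sigma_finite "\<lambda>_. \<Pi>\<^sub>M j\<in>J. unit_law"
    by (simp add: product_sigma_finite_def prob_space_PiM_unit_law prob_space_imp_sigma_finite)
  show ?thesis
  proof (rule U.PiM_eqI)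
    fix A :: "_ \<Rightarrow> real set" assume A: "\<And>z. z \<in> I \<times> J \<Longrightarrow> A z \<in> sets unit_law"
    have "?f -` Pi\<^sub>E (I \<times> J) A \<inter> space ?A = (\<Pi>\<^sub>E i\<in>I. \<Pi>\<^sub>E j\<in>J. A (i, j))"
      by (auto simp: space_PiM PiE_iff extensional_def)
    moreover have "Pi\<^sub>E (I \<times> J) A \<in> sets ?P"
      using A assms by (intro sets_PiM_I_finite) auto
    ultimately have "emeasure (distr ?A ?P ?f) (Pi\<^sub>E (I \<times> J) A) = emeasure ?A (\<Pi>\<^sub>E i\<in>I. \<Pi>\<^sub>E j\<in>J. A (i, j))"
      by (simp add: emeasure_distr[OF measurable_PiM_flatten])
    also have "\<dots> = (\<Prod>i\<in>I. emeasure (\<Pi>\<^sub>M j\<in>J. unit_law) (\<Pi>\<^sub>E j\<in>J. A (i, j)))"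
      using A assms by (intro J.emeasure_PiM sets_PiM_I_finite) auto
    also have "\<dots> = (\<Prod>i\<in>I. \<Prod>j\<in>J. emeasure unit_law (A (i, j)))"
      using A assms by (intro prod.cong U.emeasure_PiM) auto
    also have "\<dots> = (\<Prod>z\<in>I \<times> J. emeasure unit_law (A z))"
      by (simp add: prod.cartesian_product)
    finally show "emeasure (distr ?A ?P ?f) (Pi\<^sub>E (I \<times> J) A) = (\<Prod>z\<in>I \<times> J. emeasure unit_law (A z))" .
  qed (use assms in auto)
qed

text \<open>This is the flattening for the opposite nesting, followed by the reindexing along
  \<open>prod.swap\<close>.\<close>

lemma distr_PiM_flatten_swap:
  assumes "finite I" "finite J"
  shows "distr (\<Pi>\<^sub>M j\<in>J. \<Pi>\<^sub>M i\<in>I. unit_law) (\<Pi>\<^sub>M z\<in>I \<times> J. unit_law)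
    (\<lambda>X. \<lambda>z\<in>I \<times> J. X (snd z) (fst z)) = (\<Pi>\<^sub>M z\<in>I \<times> J. unit_law)"
    (is "distr ?B ?P ?g = ?P")
proof -
  let ?Q = "\<Pi>\<^sub>M z\<in>J \<times> I. unit_law"
  let ?h = "\<lambda>Z. \<lambda>z\<in>I \<times> J. Z (prod.swap z)"
  have "?P = distr ?Q ?P ?h"
    by (intro distr_PiM_reindex[symmetric] prob_space_unit_law) (auto simp: inj_on_def)
  also have "\<dots> = distr (distr ?B ?Q (\<lambda>X. \<lambda>z\<in>J \<times> I. X (fst z) (snd z))) ?P ?h"
    by (simp add: distr_PiM_flatten[OF assms(2,1)])
  also have "\<dots> = distr ?B ?P (?h \<circ> (\<lambda>X. \<lambda>z\<in>J \<times> I. X (fst z) (snd z)))"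
    by (intro distr_distr measurable_PiM_flatten measurable_restrict measurable_component_singleton) auto
  also have "?h \<circ> (\<lambda>X. \<lambda>z\<in>J \<times> I. X (fst z) (snd z)) = ?g"
    by (auto simp: fun_eq_iff)
  finally show ?thesis ..
qed

text \<open>Positions are grouped by vertex, while the event is a conjunction over coordinates.
  Passing through the product over pairs regroups them by coordinate, and the event becomes a box
  with the same side \<open>E\<close> for every \<open>j\<close>.\<close>

lemma emeasure_PiM_transpose:
  assumes I: "finite I" "finite J" and E: "E \<in> sets (\<Pi>\<^sub>M i\<in>I. unit_law)"
  shows "emeasure (\<Pi>\<^sub>M i\<in>I. \<Pi>\<^sub>M j\<in>J. unit_law)
      {X \<in> space (\<Pi>\<^sub>M i\<in>I. \<Pi>\<^sub>M j\<in>J. unit_law). \<forall>j\<in>J. (\<lambda>i\<in>I. X i j) \<in> E}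
    = emeasure (\<Pi>\<^sub>M i\<in>I. unit_law) E ^ card J"
proof -
  let ?A = "\<Pi>\<^sub>M i\<in>I. \<Pi>\<^sub>M j\<in>J. unit_law" and ?B = "\<Pi>\<^sub>M j\<in>J. \<Pi>\<^sub>M i\<in>I. unit_law" and ?P = "\<Pi>\<^sub>M z\<in>I \<times> J. unit_law"
  let ?f = "\<lambda>X. \<lambda>z\<in>I \<times> J. X (fst z) (snd z)" and ?g = "\<lambda>X. \<lambda>z\<in>I \<times> J. X (snd z) (fst z)"
  interpret B: product_sigma_finite "\<lambda>_. \<Pi>\<^sub>M i\<in>I. unit_law"
    by (simp add: product_sigma_finite_def prob_space_PiM_unit_law prob_space_imp_sigma_finite)
  define F where "F = {Z \<in> space ?P. \<forall>j\<in>J. (\<lambda>i\<in>I. Z (i, j)) \<in> E}"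
  have fm: "?f \<in> measurable ?A ?P"
    by (rule measurable_PiM_flatten)
  have gm: "?g \<in> measurable ?B ?P"
  proof (rule measurable_restrict)
    fix z assume "z \<in> I \<times> J"
    then show "(\<lambda>Y. Y (snd z) (fst z)) \<in> measurable ?B unit_law"
      by (intro measurable_compose[where f = "\<lambda>X. X (snd z)" and g = "\<lambda>x. x (fst z)" and N = "\<Pi>\<^sub>M i\<in>I. unit_law"]
      measurable_component_singleton) auto
  qed
  have "{Z \<in> space ?P. (\<lambda>i\<in>I. Z (i, j)) \<in> E} \<in> sets ?P" if "j \<in> J" for j
  proof -
    have "(\<lambda>Z. \<lambda>i\<in>I. Z (i, j)) \<in> measurable ?P (\<Pi>\<^sub>M i\<in>I. unit_law)"
      using that by (intro measurable_restrict measurable_component_singleton) auto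
    from measurable_sets[OF this E] show ?thesis by (simp add: vimage_def Int_def conj_commute)
  qed
  then have F: "F \<in> sets ?P" unfolding F_def using I by (intro sets.sets_Collect_finite_All) auto
  have "{X \<in> space ?A. \<forall>j\<in>J. (\<lambda>i\<in>I. X i j) \<in> E} = ?f -` F \<inter> space ?A"
  proof -
    have "(\<lambda>i\<in>I. ?f X (i, j)) = (\<lambda>i\<in>I. X i j)" if "j \<in> J" for X :: "_ \<Rightarrow> _ \<Rightarrow> real" and j
      using that by (auto simp: fun_eq_iff)
    then show ?thesis using measurable_space[OF fm] by (auto simp: F_def)
  qed
  then have "emeasure ?A {X \<in> space ?A. \<forall>j\<in>J. (\<lambda>i\<in>I. X i j) \<in> E} = emeasure ?P F"
    using emeasure_distr[OF fm F] unfolding distr_PiM_flatten[OF I] by simp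
  also have "\<dots> = emeasure ?B (?g -` F \<inter> space ?B)"
    using emeasure_distr[OF gm F] unfolding distr_PiM_flatten_swap[OF I] by simp
  also have "?g -` F \<inter> space ?B = Pi\<^sub>E J (\<lambda>_. E)"
  proof -
    have "(\<lambda>i\<in>I. ?g Y (i, j)) = Y j" if "j \<in> J" "Y \<in> space ?B" for Y j
      using that by (auto simp: fun_eq_iff space_PiM PiE_iff extensional_def)
    then have "?g -` F \<inter> space ?B = {Y \<in> space ?B. \<forall>j\<in>J. Y j \<in> E}"
      using measurable_space[OF gm] by (auto simp: F_def)
    also have "\<dots> = Pi\<^sub>E J (\<lambda>_. E)"
      using sets.sets_into_space[OF E] by (auto simp: space_PiM[of J] PiE_iff intro: extensional_arb)
    finally show ?thesis .
  qed
  also have "emeasure ?B \<dots> = emeasure (\<Pi>\<^sub>M i\<in>I. unit_law) E ^ card J"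
    using E I by (simp add: B.emeasure_PiM)
  finally show ?thesis .
qed

text \<open>As \<open>circ_dist\<close> never exceeds \<open>1 / 2\<close>, the choice \<open>t = 1 / 2\<close> leaves only the condition for the star.\<close>

definition cluster_event :: "nat \<Rightarrow> nat \<Rightarrow> real \<Rightarrow> real \<Rightarrow> (nat \<Rightarrow> nat) \<Rightarrow> (nat \<Rightarrow> nat \<Rightarrow> real) \<Rightarrow> bool" where
  "cluster_event d k s t v X \<longleftrightarrow> (\<forall>m\<in>{1..d}.
     (\<forall>i\<in>{2..k}. circ_dist (X (v 1) m) (X (v i) m) \<le> s) \<and>
     (\<forall>i\<in>{2..k}. \<forall>j\<in>{2..k}. circ_dist (X (v i) m) (X (v j) m) \<le> t))"

lemma emeasure_cluster_event:
  assumes v: "v \<in> vertex_tuples n k" and k: "2 \<le> k" and s: "0 \<le> s" "s \<le> 1 / 4" and t: "0 \<le> t"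
  shows "emeasure (\<Pi>\<^sub>M v\<in>{1..n}. torus_law d) {X \<in> space (\<Pi>\<^sub>M v\<in>{1..n}. torus_law d). cluster_event d k s t v X}
    = ennreal (cluster_volume (2 * s) (k - 1) (min t (2 * s))) ^ d"
proof -
  let ?N = "\<Pi>\<^sub>M i\<in>{1..n}. unit_law" and ?K = "\<Pi>\<^sub>M i\<in>insert 1 {2..k}. unit_law"
  define Q where "Q x \<longleftrightarrow> (\<forall>i\<in>{2..k}. circ_dist (x 1) (x i) \<le> s) \<and> (\<forall>i\<in>{2..k}. \<forall>j\<in>{2..k}. circ_dist (x i) (x j) \<le> t)"
    for x :: "nat \<Rightarrow> real"
  define S where "S = {x \<in> space ?K. Q x}"
  define E where "E = {x \<in> space ?N. Q (\<lambda>i. x (v i))}"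
  have ins: "insert 1 {2..k} = {1..k}" using k by auto
  have v1: "inj_on v {1..k}" "v \<in> {1..k} \<rightarrow> {1..n}" and vn: "\<And>i. i \<in> {1..k} \<Longrightarrow> v i \<in> {1..n}"
    using v by (auto simp: vertex_tuples_def)
  have S: "S \<in> sets ?K" unfolding S_def Q_def by measurable
  \<comment> \<open>As \<open>v\<close> is injective, the coordinates it selects are again
    independent and uniform, and the remaining vertices are integrated out.\<close>
  have d: "distr ?N ?K (\<lambda>x. \<lambda>i\<in>insert 1 {2..k}. x (v i)) = ?K"
    unfolding ins using v1 by (intro distr_PiM_reindex prob_space_unit_law)
  have m: "(\<lambda>x. \<lambda>i\<in>insert 1 {2..k}. x (v i)) \<in> measurable ?N ?K"
    unfolding ins using vn by (intro measurable_restrict measurable_component_singleton)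
  have Q_restrict: "Q (\<lambda>i\<in>insert 1 {2..k}. x (v i)) \<longleftrightarrow> Q (\<lambda>i. x (v i))" for x
    by (auto simp: Q_def)
  have E_eq: "E = (\<lambda>x. \<lambda>i\<in>insert 1 {2..k}. x (v i)) -` S \<inter> space ?N"
    using measurable_space[OF m] by (auto simp: E_def S_def Q_restrict simp del: One_nat_def)
  have E: "E \<in> sets ?N" unfolding E_eq by (rule measurable_sets[OF m S])
  have "emeasure ?N E = emeasure ?K S"
    using emeasure_distr[OF m S] unfolding d E_eq by simp
  also have "\<dots> = ennreal (cluster_volume (2 * s) (k - 1) (min t (2 * s)))"
    unfolding S_def Q_def using k s t by (subst emeasure_circle_cluster) auto
  finally have *: "emeasure ?N E = ennreal (cluster_volume (2 * s) (k - 1) (min t (2 * s)))" .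
  have "cluster_event d k s t v X \<longleftrightarrow> (\<forall>j\<in>{1..d}. (\<lambda>i\<in>{1..n}. X i j) \<in> E)" for X
  proof -
    have "(\<lambda>i\<in>{1..n}. X i j) \<in> E \<longleftrightarrow> Q (\<lambda>i. X (v i) j)" for j
    proof -
      have "Q (\<lambda>i. (\<lambda>i\<in>{1..n}. X i j) (v i)) \<longleftrightarrow> Q (\<lambda>i. X (v i) j)"
        using vn k by (auto simp: Q_def)
      then show ?thesis by (auto simp: E_def space_PiM)
    qed
    then show ?thesis by (simp add: cluster_event_def Q_def)
  qed
  then show ?thesis
    using emeasure_PiM_transpose[OF _ _ E, of "{1..d}"] * by (simp add: torus_law_def)
qed

subsection \<open>Stars and cliques\<close>

lemma torus_dist_le_iff:
  "1 \<le> d \<Longrightarrow> torus_dist d x y \<le> h \<longleftrightarrow> (\<forall>m\<in>{1..d}. circ_dist (x m) (y m) \<le> h)"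
  unfolding torus_dist_def by (subst Max_le_iff) auto

lemma conn_threshold_commute: "conn_threshold n l d a b = conn_threshold n l d b a"
  by (simp add: conn_threshold_def mult.commute)

lemma conn_threshold_nonneg: "0 \<le> conn_threshold n l d a b"
  by (simp add: conn_threshold_def)

lemma vertex_tuples_image_diff:
  assumes "v \<in> vertex_tuples n k" "1 \<le> k"
  shows "v ` {1..k} - {v 1} = v ` {2..k}"
proof -
  have inj: "inj_on v {1..k}" using assms by (simp add: vertex_tuples_def)
  have "v ` {1..k} - {v 1} = v ` ({1..k} - {1})"
    using inj_on_image_set_diff[OF inj, of "{1..k}" "{1}"] assms by auto
  also have "{1..k} - {1} = {2..k}" by auto
  finally show ?thesis .
qed

text \<open>With these weights the clause on weights in \<open>star_event\<close> follows from
  \<open>wu \<le> c ^ d * w1\<close>, so only conditions on positions are left.\<close>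

lemma star_event_iff_cluster_event:
  assumes v: "v \<in> vertex_tuples n k" and "1 \<le> d" "1 \<le> k"
    and W: "W (v 1) = w1" "\<And>i. i \<in> {2..k} \<Longrightarrow> W (v i) = wu" and "wu \<le> c ^ d * w1"
  shows "star_event n l d k c v (W, X) \<longleftrightarrow>
    cluster_event d k (conn_threshold n l d w1 wu) (1 / 2) v X"
proof -
  have half: "circ_dist x y * 2 \<le> 1" for x y using circ_dist_le_half[of x y] by simp
  have inj: "inj_on v {1..k}" using v by (simp add: vertex_tuples_def)
  have ne: "v 1 \<noteq> v i" if "i \<in> {2..k}" for i
    using inj_onD[OF inj, of 1 i] that by auto
  show ?thesis
    unfolding star_event_def vertex_tuples_image_diff[OF v \<open>1 \<le> k\<close>]
    using assms ne
    by (auto simp: girg_adj_def torus_dist_le_iff cluster_event_def half simp del: One_nat_def)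
qed

text \<open>A clique contains the star at \<open>v 1\<close>, so the conjunction amounts to the
  clique alone. Its edges are those at \<open>v 1\<close>, with threshold \<open>?s\<close>, and
  those among the other vertices, with threshold \<open>?t\<close>.\<close>

lemma clique_star_iff_cluster_event:
  assumes v: "v \<in> vertex_tuples n k" and d: "1 \<le> d" and k: "1 \<le> k"
    and W: "W (v 1) = w1" "\<And>i. i \<in> {2..k} \<Longrightarrow> W (v i) = wu" and c: "wu \<le> c ^ d * w1"
  shows "is_clique (girg_adj n l d (W, X)) (v ` {1..k}) \<and> star_event n l d k c v (W, X) \<longleftrightarrow>
    cluster_event d k (conn_threshold n l d w1 wu) (conn_threshold n l d wu wu) v X"
    (is "?C \<and> ?S \<longleftrightarrow> cluster_event d k ?s ?t v X")
proof -
  have half: "circ_dist x y * 2 \<le> 1" for x y using circ_dist_le_half[of x y] by simp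
  have inj: "inj_on v {1..k}" using v by (simp add: vertex_tuples_def)
  have ne: "v i \<noteq> v j" if "i \<in> {1..k}" "j \<in> {1..k}" "i \<noteq> j" for i j
    using inj_onD[OF inj, of i j] that by auto
  have adj1: "girg_adj n l d (W, X) (v 1) (v i) \<longleftrightarrow> (\<forall>m\<in>{1..d}. circ_dist (X (v 1) m) (X (v i) m) \<le> ?s)"
    "girg_adj n l d (W, X) (v i) (v 1) \<longleftrightarrow> (\<forall>m\<in>{1..d}. circ_dist (X (v 1) m) (X (v i) m) \<le> ?s)"
    if "i \<in> {2..k}" for i
    using that ne[of 1 i] d W
    by (auto simp: girg_adj_def torus_dist_le_iff circ_dist_commute[of _ "X (v 1) _"]
        conn_threshold_commute[of _ _ _ wu w1] simp del: One_nat_def)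
  have adj2: "girg_adj n l d (W, X) (v i) (v j) \<longleftrightarrow> (\<forall>m\<in>{1..d}. circ_dist (X (v i) m) (X (v j) m) \<le> ?t)"
    if "i \<in> {2..k}" "j \<in> {2..k}" "i \<noteq> j" for i j
    using that ne[of i j] d W by (auto simp: girg_adj_def torus_dist_le_iff simp del: One_nat_def)
  have ins: "{1..k} = insert 1 {2..k}" using k by auto
  \<comment> \<open>\<open>cluster_event\<close> includes the pairs with \<open>i = j\<close>, which
    are no edges; a nonnegative threshold makes them harmless.\<close>
  have self: "circ_dist x x \<le> ?t" for x
    using conn_threshold_nonneg[of n l d wu wu] by (simp add: circ_dist_def)
  have "?C \<longleftrightarrow> (\<forall>i\<in>{1..k}. \<forall>j\<in>{1..k}. i \<noteq> j \<longrightarrow> girg_adj n l d (W, X) (v i) (v j))"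
    using ne by (auto simp: is_clique_def simp del: One_nat_def)
  also have "\<dots> \<longleftrightarrow> (\<forall>i\<in>{2..k}. girg_adj n l d (W, X) (v 1) (v i) \<and> girg_adj n l d (W, X) (v i) (v 1)) \<and>
      (\<forall>i\<in>{2..k}. \<forall>j\<in>{2..k}. i \<noteq> j \<longrightarrow> girg_adj n l d (W, X) (v i) (v j))"
    unfolding ins by auto
  also have "\<dots> \<longleftrightarrow> cluster_event d k ?s ?t v X"
  proof -
    have "(\<forall>i\<in>{2..k}. \<forall>j\<in>{2..k}. i \<noteq> j \<longrightarrow> girg_adj n l d (W, X) (v i) (v j)) \<longleftrightarrow>
        (\<forall>i\<in>{2..k}. \<forall>j\<in>{2..k}. \<forall>m\<in>{1..d}. circ_dist (X (v i) m) (X (v j) m) \<le> ?t)"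
      using adj2 self by metis
    moreover have "(\<forall>i\<in>{2..k}. girg_adj n l d (W, X) (v 1) (v i) \<and> girg_adj n l d (W, X) (v i) (v 1)) \<longleftrightarrow>
        (\<forall>i\<in>{2..k}. \<forall>m\<in>{1..d}. circ_dist (X (v 1) m) (X (v i) m) \<le> ?s)"
      using adj1 by metis
    ultimately show ?thesis unfolding cluster_event_def by blast
  qed
  finally have C: "?C \<longleftrightarrow> cluster_event d k ?s ?t v X" .
  moreover have "?S" if "cluster_event d k ?s ?t v X"
    using that by (subst star_event_iff_cluster_event[where W = W, OF v d k W c]) (auto simp: cluster_event_def half)
  ultimately show ?thesis by blast
qed

section \<open>Measurability of the events\<close>

lemma borel_measurable_girg_weight:
  assumes "u \<in> {1..n}"
  shows "(\<lambda>G. fst G u) \<in> borel_measurable (girg n \<beta> w0 d)"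
proof -
  have "(\<lambda>W. W u) \<in> measurable (\<Pi>\<^sub>M v\<in>{1..n}. weight_law \<beta> w0) (weight_law \<beta> w0)"
    using assms by (rule measurable_component_singleton)
  then have "(\<lambda>W. W u) \<in> borel_measurable (\<Pi>\<^sub>M v\<in>{1..n}. weight_law \<beta> w0)"
    by (simp add: measurable_cong_sets[OF refl sets_weight_law])
  then show ?thesis
    unfolding girg_def by (rule measurable_compose[OF measurable_fst])
qed

lemma borel_measurable_position:
  assumes "u \<in> {1..n}" "m \<in> {1..d}"
  shows "(\<lambda>X. X u m) \<in> borel_measurable (\<Pi>\<^sub>M v\<in>{1..n}. torus_law d)"
proof -
  have "(\<lambda>X. X u) \<in> measurable (\<Pi>\<^sub>M v\<in>{1..n}. torus_law d) (torus_law d)"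
    using assms(1) by (rule measurable_component_singleton)
  moreover have "(\<lambda>x. x m) \<in> borel_measurable (torus_law d)"
    unfolding torus_law_def using assms(2) by (rule borel_measurable_unit_law_component)
  ultimately show ?thesis by (rule measurable_compose)
qed

lemma borel_measurable_girg_position:
  assumes "u \<in> {1..n}" "m \<in> {1..d}"
  shows "(\<lambda>G. snd G u m) \<in> borel_measurable (girg n \<beta> w0 d)"
  unfolding girg_def using borel_measurable_position[OF assms] by (rule measurable_compose[OF measurable_snd])

lemma pred_girg_adj:
  assumes d: "1 \<le> d" and u: "u \<in> {1..n}" and v: "v \<in> {1..n}"
  shows "Measurable.pred (girg n \<beta> w0 d) (\<lambda>G. girg_adj n l d G u v)"
proof -
  have [measurable]: "(\<lambda>G. snd G u m) \<in> borel_measurable (girg n \<beta> w0 d)"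
    "(\<lambda>G. snd G v m) \<in> borel_measurable (girg n \<beta> w0 d)" if "m \<in> {1..d}" for m
    using borel_measurable_girg_position u v that by auto
  have [measurable]: "(\<lambda>G. fst G u) \<in> borel_measurable (girg n \<beta> w0 d)"
    "(\<lambda>G. fst G v) \<in> borel_measurable (girg n \<beta> w0 d)"
    using borel_measurable_girg_weight u v by auto
  have [measurable]: "(\<lambda>G. conn_threshold n l d (fst G u) (fst G v)) \<in> borel_measurable (girg n \<beta> w0 d)"
    unfolding conn_threshold_def by measurable
  have "Measurable.pred (girg n \<beta> w0 d)
      (\<lambda>G. \<forall>m\<in>{1..d}. circ_dist (snd G u m) (snd G v m) \<le> conn_threshold n l d (fst G u) (fst G v))"
    by (intro pred_intros_finite(3)) measurable
  moreover have "girg_adj n l d G u v \<longleftrightarrow> u \<noteq> v \<and>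
      (\<forall>m\<in>{1..d}. circ_dist (snd G u m) (snd G v m) \<le> conn_threshold n l d (fst G u) (fst G v))" for G
    by (cases G) (simp add: girg_adj_def torus_dist_le_iff[OF d])
  ultimately show ?thesis by (simp only: pred_intros_conj1')
qed

lemma pred_star_event:
  assumes v: "v \<in> vertex_tuples n k" and d: "1 \<le> d" and k: "1 \<le> k"
  shows "Measurable.pred (girg n \<beta> w0 d) (star_event n l d k c v)"
proof -
  have vn: "v i \<in> {1..n}" if "i \<in> {1..k}" for i using v that by (auto simp: vertex_tuples_def)
  have "Measurable.pred (girg n \<beta> w0 d) (\<lambda>G. girg_adj n l d G (v 1) u \<and> fst G u \<le> c ^ d * fst G (v 1))"
    if "u \<in> v ` {1..k} - {v 1}" for u
  proof -
    have u: "u \<in> {1..n}" using that vn by auto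
    have v1: "v 1 \<in> {1..n}" using vn k by auto
    note [measurable] = pred_girg_adj[OF d v1 u] borel_measurable_girg_weight[OF u] borel_measurable_girg_weight[OF v1]
    show ?thesis by measurable
  qed
  then have "Measurable.pred (girg n \<beta> w0 d) (\<lambda>G. \<forall>u \<in> v ` {1..k} - {v 1}. girg_adj n l d G (v 1) u \<and> fst G u \<le> c ^ d * fst G (v 1))"
    by (intro pred_intros_finite(3)) auto
  then show ?thesis unfolding star_event_def[abs_def] .
qed

lemma pred_clique:
  assumes v: "v \<in> vertex_tuples n k" and d: "1 \<le> d"
  shows "Measurable.pred (girg n \<beta> w0 d) (\<lambda>G. is_clique (girg_adj n l d G) (v ` {1..k}))"
proof -
  have "u \<in> {1..n}" if "u \<in> v ` {1..k}" for u using v that by (auto simp: vertex_tuples_def)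
  then have "Measurable.pred (girg n \<beta> w0 d) (\<lambda>G. u \<noteq> w \<longrightarrow> girg_adj n l d G u w)"
    if "u \<in> v ` {1..k}" "w \<in> v ` {1..k}" for u w
    using that by (intro pred_intros_imp'[where P = "\<lambda>G. girg_adj n l d G u w"] pred_girg_adj[OF d])
  then show ?thesis
    unfolding is_clique_def by (intro pred_intros_finite(3) finite_imageI finite_atLeastAtMost)
qed

lemma pred_cluster_event:
  assumes v: "v \<in> vertex_tuples n k" and k: "1 \<le> k"
  shows "Measurable.pred (\<Pi>\<^sub>M v\<in>{1..n}. torus_law d) (cluster_event d k s t v)"
proof -
  have X: "(\<lambda>X. X (v i) m) \<in> borel_measurable (\<Pi>\<^sub>M v\<in>{1..n}. torus_law d)"
    if "1 \<le> i" "i \<le> k" "m \<in> {1..d}" for i m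
    using v that by (intro borel_measurable_position) (auto simp: vertex_tuples_def)
  show ?thesis
    unfolding cluster_event_def[abs_def] using k
    by (intro pred_intros_finite(3) pred_intros_logic(3)
        borel_measurable_le[unfolded pred_def[symmetric]] borel_measurable_circ_dist X borel_measurable_const) auto
qed

subsection \<open>Conditioned random graphs\<close>

text \<open>The point masses fix the weights on the tuple almost surely, so \<open>P\<close> need be
  known only for those weights, where it is a condition on positions.\<close>

lemma emeasure_girg_given:
  assumes w: "w0 > 0" "\<beta> > 2" and v: "v \<in> vertex_tuples n k" and k: "2 \<le> k"
    and s: "0 \<le> s" "s \<le> 1 / 4" and t: "0 \<le> t"
    and P: "Measurable.pred (girg n \<beta> w0 d) P"
    and eq: "\<And>W X. W (v 1) = w1 \<Longrightarrow> (\<And>i. i \<in> {2..k} \<Longrightarrow> W (v i) = wu) \<Longrightarrow>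
      P (W, X) \<longleftrightarrow> cluster_event d k s t v X"
  defines "M \<equiv> girg_given n \<beta> w0 d (v ` {1..k}) (\<lambda>u. if u = v 1 then w1 else wu)"
  shows "emeasure M {G \<in> space M. P G} = ennreal (cluster_volume (2 * s) (k - 1) (min t (2 * s))) ^ d"
proof -
  let ?f = "\<lambda>u. if u = v 1 then w1 else wu"
  define R where "R u = (if u \<in> v ` {1..k} then return borel (?f u) else weight_law \<beta> w0)" for u
  define A where "A = (\<Pi>\<^sub>M u\<in>{1..n}. R u)"
  define B where "B = (\<Pi>\<^sub>M v\<in>{1..n}. torus_law d)"
  have M: "M = A \<Otimes>\<^sub>M B" unfolding M_def girg_given_def A_def B_def R_def[abs_def] ..
  have R: "prob_space (R u)" for u
    using real_distribution_weight_law[OF w] by (auto simp: R_def real_distribution_def prob_space_return)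
  interpret A: prob_space A unfolding A_def by (intro prob_space_PiM R)
  interpret B: prob_space B unfolding B_def by (intro prob_space_PiM prob_space_torus_law)
  interpret pair_prob_space A B ..
  have vn: "v i \<in> {1..n}" if "i \<in> {1..k}" for i using v that by (auto simp: vertex_tuples_def)
  have inj: "inj_on v {1..k}" using v by (simp add: vertex_tuples_def)
  have AE1: "AE W in A. W u = ?f u" if "u \<in> v ` {1..k}" for u
  proof -
    have "R u = return borel (?f u)" using that by (simp add: R_def)
    moreover have "AE x in return borel (?f u). x = ?f u" by (subst AE_return) auto
    ultimately have "AE x in R u. x = ?f u" by (simp only:)
    then show ?thesis unfolding A_def using that vn R by (intro AE_PiM_component) auto
  qed
  have "AE W in A. \<forall>u\<in>v ` {1..k}. W u = ?f u"
    by (intro AE_finite_allI AE1) auto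
  then have "AE G in distr M A fst. \<forall>u\<in>v ` {1..k}. G u = ?f u"
    unfolding M B.distr_pair_fst .
  then have AE: "AE G in M. \<forall>u\<in>v ` {1..k}. fst G u = ?f u"
    by (rule AE_distrD[rotated]) (simp add: M)
  define C where "C = {X \<in> space B. cluster_event d k s t v X}"
  have C: "C \<in> sets B"
    unfolding C_def B_def using pred_cluster_event[OF v] k by (simp add: pred_def)
  have sets_M: "sets M = sets (girg n \<beta> w0 d)" unfolding M_def by (rule sets_girg_given)
  \<comment> \<open>Up to a null set the event is a cylinder over the positions, whose measure is
    that of its base \<open>C\<close>.\<close>
  have "emeasure M {G \<in> space M. P G} = emeasure M (space A \<times> C)"
  proof (rule emeasure_eq_AE)
    show "AE G in M. G \<in> {G \<in> space M. P G} \<longleftrightarrow> G \<in> space A \<times> C"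
      using AE AE_space
    proof eventually_elim
      fix G assume G: "\<forall>u\<in>v ` {1..k}. fst G u = ?f u" "G \<in> space M"
      have 1: "fst G (v 1) = w1" using G(1) k by auto
      \<comment> \<open>Injectivity gives \<open>v i \<noteq> v 1\<close>, which selects the second
        branch of the weight function.\<close>
      have "fst G (v i) = wu" if "i \<in> {2..k}" for i
        using G(1) that inj_onD[OF inj, of i 1] by auto
      from eq[where W = "fst G" and X = "snd G", OF 1 this] have "P G \<longleftrightarrow> cluster_event d k s t v (snd G)" by simp
      then show "G \<in> {G \<in> space M. P G} \<longleftrightarrow> G \<in> space A \<times> C"
        using G(2) by (cases G) (auto simp: M C_def space_pair_measure)
    qed
    show "{G \<in> space M. P G} \<in> sets M"
      using P unfolding pred_def sets_M sets_eq_imp_space_eq[OF sets_M] .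
    show "space A \<times> C \<in> sets M" unfolding M using C by auto
  qed
  also have "\<dots> = emeasure B C"
    unfolding M using C by (simp add: B.emeasure_pair_measure_Times A.emeasure_space_1)
  also have "\<dots> = ennreal (cluster_volume (2 * s) (k - 1) (min t (2 * s))) ^ d"
    unfolding C_def B_def by (rule emeasure_cluster_event) fact+
  finally show ?thesis .
qed

text \<open>The sample is a mixture over tuples; if the event has the same probability
  \<open>p\<close> for every tuple, averaging over the tuples returns \<open>p\<close>.\<close>

lemma measure_girg_sample:
  assumes w: "w0 > 0" "\<beta> > 2" and k: "k \<le> n" and p: "0 \<le> p"
    and P: "\<And>v. v \<in> vertex_tuples n k \<Longrightarrow> Measurable.pred (girg n \<beta> w0 d) (P v)"
    and given: "\<And>v M. v \<in> vertex_tuples n k \<Longrightarrow>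
      M = girg_given n \<beta> w0 d (v ` {1..k}) (\<lambda>u. if u = v 1 then w1 else wu) \<Longrightarrow>
      emeasure M {G \<in> space M. P v G} = ennreal p"
  shows "\<P>(\<omega> in girg_sample n \<beta> w0 d k w1 wu. P (fst \<omega>) (snd \<omega>)) = p"
proof -
  let ?T = "vertex_tuples n k"
  let ?N = "count_space ?T \<Otimes>\<^sub>M girg n \<beta> w0 d"
  let ?g = "\<lambda>v. girg_given n \<beta> w0 d (v ` {1..k}) (\<lambda>u. if u = v 1 then w1 else wu)"
  let ?K = "\<lambda>v. distr (?g v) ?N (\<lambda>G. (v, G))"
  let ?E = "{\<omega> \<in> space ?N. P (fst \<omega>) (snd \<omega>)}"
  have m: "(\<lambda>G. (v, G)) \<in> measurable (?g v) ?N" if "v \<in> ?T" for v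
    unfolding measurable_cong_sets[OF sets_girg_given refl] using that by (intro measurable_Pair) auto
  have "prob_space (?K v)" if "v \<in> ?T" for v
    using m[OF that] by (rule prob_space.prob_space_distr[OF prob_space_girg_given[OF w]])
  then have "?K \<in> measurable (count_space ?T) (subprob_algebra ?N)"
    by (auto simp: space_subprob_algebra prob_space_imp_subprob_space)
  then have K: "?K \<in> measurable (uniform_count_measure ?T) (subprob_algebra ?N)"
    by (simp add: measurable_cong_sets[OF sets_uniform_count_measure_count_space refl])
  \<comment> \<open>There are finitely many tuples, so joint measurability reduces to measurability
    for each fixed tuple.\<close>
  have "Measurable.pred ?N (\<lambda>\<omega>. P (fst \<omega>) (snd \<omega>))"
    using P by (intro measurable_pair_measure_countable1) (auto simp: countable_finite finite_vertex_tuples)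
  then have E: "?E \<in> sets ?N" by (simp add: pred_def)
  interpret U: prob_space "uniform_count_measure ?T"
    by (intro prob_space_uniform_count_measure finite_vertex_tuples vertex_tuples_nonempty k)
  have "emeasure (girg_sample n \<beta> w0 d k w1 wu) ?E = (\<integral>\<^sup>+ v. emeasure (?K v) ?E \<partial>uniform_count_measure ?T)"
    unfolding girg_sample_def by (rule emeasure_bind[OF U.not_empty K E])
  also have "\<dots> = (\<integral>\<^sup>+ v. ennreal p \<partial>uniform_count_measure ?T)"
  proof (rule nn_integral_cong)
    fix v assume "v \<in> space (uniform_count_measure ?T)"
    then have v: "v \<in> ?T" by (simp add: space_uniform_count_measure)
    have "emeasure (?K v) ?E = emeasure (?g v) {G \<in> space (?g v). P v G}"
      using measurable_space[OF m[OF v]]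
      by (subst emeasure_distr[OF m[OF v] E]) (auto intro!: arg_cong[where f = "emeasure _"])
    also have "\<dots> = ennreal p" by (rule given[OF v refl])
    finally show "emeasure (?K v) ?E = ennreal p" .
  qed
  also have "\<dots> = ennreal p" by (simp add: U.emeasure_space_1)
  finally have "measure (girg_sample n \<beta> w0 d k w1 wu) ?E = p" using p by (simp add: measure_def)
  then show ?thesis
    using sets_eq_imp_space_eq[OF sets_girg_sample[OF w k, of d w1 wu]] by simp
qed

section \<open>From volumes to the closed formula\<close>

lemma cluster_volume_diameter: "1 \<le> m \<Longrightarrow> cluster_volume r m r = r ^ m"
  by (cases m) (auto simp: cluster_volume_def algebra_simps)

text \<open>After factoring out \<open>t ^ (m - 1)\<close>, both remaining terms are nonnegative.
  This is what allows the extended nonnegative measures to be read as real probabilities.\<close>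

lemma cluster_volume_nonneg:
  assumes "1 \<le> m" "0 \<le> t" "t \<le> r"
  shows "0 \<le> cluster_volume r m t"
proof -
  have "cluster_volume r m t = t ^ (m - 1) * (real m * (r - t) + t)"
    using assms by (cases m) (auto simp: cluster_volume_def algebra_simps)
  also have "0 \<le> \<dots>" using assms by simp
  finally show ?thesis .
qed

theorem lemma12:
  fixes l w0 \<beta> c w1 wu :: real and n d k :: nat
  assumes "l > 0" and "w0 > 0" and "\<beta> > 2"
    and "d \<ge> 1" and "k \<ge> 3" and "k \<le> n"
    and "w0 \<le> w1" and "w1 \<le> wu"
    and "c \<ge> 1"
    and "c\<^sup>2 * (w1\<^sup>2 / (girg_tau l d * real n)) powr (1 / real d) \<le> 1 / 4"
    and "wu \<le> c ^ d * w1"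
    and "wu \<le> 2 ^ d * w1"
  shows "\<P>((v, G) in girg_sample n \<beta> w0 d k w1 wu.
            is_clique (girg_adj n l d G) (v ` {1..k}) \<bar> star_event n l d k c v G)
         = (wu / w1) ^ (k - 2) *
           ((1 / 2) ^ (k - 1) *
             ((2 - real k) * (wu / w1) powr (1 / real d) + 2 * (real k - 1))) ^ d"
proof -
  define D where "D = girg_tau l d * real n"
  define r where "r = (wu / w1) powr (1 / real d)"
  define s where "s = conn_threshold n l d w1 wu"
  define t where "t = conn_threshold n l d wu wu"
  have D: "D > 0" using assms by (simp add: D_def girg_tau_def)
  have w: "0 < w1" "0 < wu" using assms by auto
  \<comment> \<open>This is used with \<open>b = 2\<close> and \<open>b = c\<close>, for the two
    upper bounds on \<open>wu\<close>.\<close>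
  have root_le: "r \<le> b" if "1 \<le> b" "wu \<le> b ^ d * w1" for b
  proof -
    have "r \<le> (b ^ d) powr (1 / real d)"
      unfolding r_def using w that by (intro powr_mono2) (auto simp: field_simps)
    also have "b ^ d = b powr real d" using that by (simp add: powr_realpow)
    also have "(b powr real d) powr (1 / real d) = b" using that assms by (simp add: powr_powr)
    finally show ?thesis .
  qed
  have r: "0 < r" "r \<le> 2" "r \<le> c" using w root_le assms by (auto simp: r_def)
  have "r ^ d = r powr real d" using r by (simp add: powr_realpow)
  also have "\<dots> = wu / w1" using w assms by (simp add: r_def powr_powr)
  finally have rd: "r ^ d = wu / w1" .
  \<comment> \<open>The threshold between two vertices of weight \<open>w1\<close>: each replacement
    of a \<open>w1\<close> by \<open>wu\<close> multiplies it by \<open>r\<close>, giving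
    \<open>s = r * s0\<close> and \<open>t = r * s\<close>.\<close>
  define s0 where "s0 = (w1\<^sup>2 / D) powr (1 / real d)"
  have s0: "0 < s0" using w D by (simp add: s0_def)
  have s_eq: "s = r * s0"
    unfolding s_def conn_threshold_def D_def[symmetric] r_def s0_def using w D
    by (simp flip: powr_mult add: power2_eq_square mult.commute)
  have t_eq: "t = r * s"
    unfolding s_eq t_def conn_threshold_def D_def[symmetric] r_def s0_def using w D
    by (simp flip: powr_mult add: power2_eq_square mult.commute)
  have r1: "1 \<le> r" using assms w by (auto simp: r_def ge_one_powr_ge_zero)
  \<comment> \<open>The hypothesis on \<open>c\<close> bounds \<open>c\<^sup>2 * s0\<close>, and
    \<open>1 \<le> r \<le> c\<close> brings \<open>s\<close> below it.\<close>
  have "s \<le> r\<^sup>2 * s0" using r1 s0 by (simp add: s_eq power2_eq_square)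
  also have "\<dots> \<le> c\<^sup>2 * s0" using r s0 by (intro mult_right_mono power_mono) auto
  also have "\<dots> \<le> 1 / 4" using assms by (simp add: s0_def D_def)
  finally have s: "0 < s" "s \<le> 1 / 4" using r s0 by (auto simp: s_eq)
  \<comment> \<open>The bound \<open>t \<le> 2 * s\<close> is \<open>r \<le> 2\<close>; it resolves
    the minimum in the clique volume to \<open>t\<close>.\<close>
  have t: "0 \<le> t" "t \<le> 2 * s" using r s by (auto simp: t_eq)
  have k: "1 \<le> k" "2 \<le> k" "1 \<le> k - 1" using assms by auto
  have den: "\<P>(\<omega> in girg_sample n \<beta> w0 d k w1 wu. star_event n l d k c (fst \<omega>) (snd \<omega>)) = ((2 * s) ^ (k - 1)) ^ d"
  proof (rule measure_girg_sample[OF \<open>w0 > 0\<close> \<open>\<beta> > 2\<close> \<open>k \<le> n\<close>])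
    fix v M assume v: "v \<in> vertex_tuples n k"
    show star: "Measurable.pred (girg n \<beta> w0 d) (star_event n l d k c v)"
      using v assms k by (intro pred_star_event) auto
    assume M: "M = girg_given n \<beta> w0 d (v ` {1..k}) (\<lambda>u. if u = v 1 then w1 else wu)"
    have "emeasure M {G \<in> space M. star_event n l d k c v G} =
        ennreal (cluster_volume (2 * s) (k - 1) (min (1 / 2) (2 * s))) ^ d"
      unfolding M
    proof (rule emeasure_girg_given)
      fix W X assume "W (v 1) = w1" "\<And>i. i \<in> {2..k} \<Longrightarrow> W (v i) = wu"
      then show "star_event n l d k c v (W, X) \<longleftrightarrow> cluster_event d k s (1 / 2) v X"
        unfolding s_def using v assms k by (intro star_event_iff_cluster_event) auto
    qed (use assms v k s star in auto)
    \<comment> \<open>The distance bound is now the length of the interval, hence vacuous, and the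
      volume is that of the full cube.\<close>
    also have "min (1 / 2) (2 * s) = 2 * s" using s by simp
    finally show "emeasure M {G \<in> space M. star_event n l d k c v G} = ennreal (((2 * s) ^ (k - 1)) ^ d)"
      using s k by (simp add: cluster_volume_diameter ennreal_power)
  qed (use s in auto)
  have num: "\<P>(\<omega> in girg_sample n \<beta> w0 d k w1 wu.
      is_clique (girg_adj n l d (snd \<omega>)) (fst \<omega> ` {1..k}) \<and> star_event n l d k c (fst \<omega>) (snd \<omega>)) = cluster_volume (2 * s) (k - 1) t ^ d"
  proof (rule measure_girg_sample[OF \<open>w0 > 0\<close> \<open>\<beta> > 2\<close> \<open>k \<le> n\<close>])
    fix v M assume v: "v \<in> vertex_tuples n k"
    show meas: "Measurable.pred (girg n \<beta> w0 d)
        (\<lambda>G. is_clique (girg_adj n l d G) (v ` {1..k}) \<and> star_event n l d k c v G)"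
      using v assms k by (intro pred_intros_logic(3) pred_clique pred_star_event) auto
    assume M: "M = girg_given n \<beta> w0 d (v ` {1..k}) (\<lambda>u. if u = v 1 then w1 else wu)"
    have "emeasure M {G \<in> space M. is_clique (girg_adj n l d G) (v ` {1..k}) \<and> star_event n l d k c v G} =
        ennreal (cluster_volume (2 * s) (k - 1) (min t (2 * s))) ^ d"
      unfolding M
    proof (rule emeasure_girg_given)
      fix W X assume "W (v 1) = w1" "\<And>i. i \<in> {2..k} \<Longrightarrow> W (v i) = wu"
      then show "is_clique (girg_adj n l d (W, X)) (v ` {1..k}) \<and> star_event n l d k c v (W, X)
          \<longleftrightarrow> cluster_event d k s t v X"
        unfolding s_def t_def using v assms k by (intro clique_star_iff_cluster_event) auto
    qed (use assms v k s t meas in auto)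
    also have "min t (2 * s) = t" using t by simp
    finally show "emeasure M {G \<in> space M. is_clique (girg_adj n l d G) (v ` {1..k}) \<and> star_event n l d k c v G}
        = ennreal (cluster_volume (2 * s) (k - 1) t ^ d)"
      using t k by (simp add: cluster_volume_nonneg ennreal_power)
  qed (use t k in \<open>auto intro!: cluster_volume_nonneg zero_le_power\<close>)
  \<comment> \<open>This substitution removes the truncated subtractions in the exponents.\<close>
  obtain j where j: "k = j + 2" using k by (metis le_add_diff_inverse2)
  \<comment> \<open>Both volumes are homogeneous of degree \<open>k - 1\<close> in \<open>s\<close>
    once \<open>t = r * s\<close> is inserted, so the ratio depends on \<open>r\<close> and
    \<open>k\<close> only.\<close>
  have "cluster_volume (2 * s) (k - 1) t / (2 * s) ^ (k - 1) =
      r ^ (k - 2) * ((1 / 2) ^ (k - 1) * ((2 - real k) * r + 2 * (real k - 1)))"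
    using s by (simp add: j cluster_volume_def t_eq power_mult_distrib field_simps)
  then have "(cluster_volume (2 * s) (k - 1) t / (2 * s) ^ (k - 1)) ^ d =
      (r ^ d) ^ (k - 2) * ((1 / 2) ^ (k - 1) * ((2 - real k) * r + 2 * (real k - 1))) ^ d"
    by (simp add: power_mult_distrib power_mult[symmetric] mult.commute)
  then have "cluster_volume (2 * s) (k - 1) t ^ d / ((2 * s) ^ (k - 1)) ^ d =
      (wu / w1) ^ (k - 2) * ((1 / 2) ^ (k - 1) * ((2 - real k) * r + 2 * (real k - 1))) ^ d"
    by (simp add: power_divide rd)
  then show ?thesis
    using num den by (simp add: cond_prob_def case_prod_beta' r_def)
qed

end
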